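(* Let $\alpha,\bar\alpha\in\mathbb{C}$ and $\Delta,\bar\Delta\in\mathbb{C}^*$. Consider extensions of conformal $\mathrm{SV}$-modules $$0\to V(\bar\alpha,\bar\Delta)\to E\to V(\alpha,\Delta)\to0,$$ realized as $E=\mathbb{C}[\partial]v_{\bar\Delta}\oplus\mathbb{C}[\partial]v_\Delta$ with $\mathbb{C}[\partial]v_{\bar\Delta}\cong V(\bar\alpha,\bar\Delta)$ a submodule and $$L_\lambda v_\Delta=(\partial+\alpha+\Delta\lambda)v_\Delta+f(\partial,\lambda)v_{\bar\Delta},\quad M_\lambda v_\Delta=g(\partial,\lambda)v_{\bar\Delta},\quad Y_\lambda v_\Delta=h(\partial,\lambda)v_{\bar\Delta},$$ with $f,g,h\in\mathbb{C}[\partial,\lambda]$. Nontrivial extensions of this form exist only if $\alpha=\bar\alpha$ and $\Delta-\bar\Delta\in\{0,2,3,4,5,6,\tfrac12,-\tfrac12,\tfrac32\}$. Writing $\bar\partial=\partial+\alpha$, the following is a complete list of values of $\Delta,\bar\Delta$ with triples $(f,g,h)$ whose nonzero scalar multiples give rise to the nontrivial extensions (up to equivalence): (i) $g=h=0$ and $f$ is one of the following (Virasoro case): $\Delta=\bar\Delta$, $f=c_0+c_1\lambda$ with $(c_0,c_1)\neq(0,0)$; $\Delta-\bar\Delta=2$, $f=\lambda^2(2\bar\partial+\lambda)$; $\Delta-\bar\Delta=3$, $f=\bar\partial\lambda^2(\bar\partial+\lambda)$; $\Delta-\bar\Delta=4$, $f=\lambda^2(4\bar\partial^3+6\bar\partial^2\lambda-\bar\partial\lambda^2+\bar\Delta\lambda^3)$;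 $(\Delta,\bar\Delta)=(1,-4)$, $f=\bar\partial^4\lambda^2-10\bar\partial^2\lambda^4-17\bar\partial\lambda^5-8\lambda^6$; $(\Delta,\bar\Delta)=(\tfrac72\pm\tfrac{\sqrt{19}}2,-\tfrac52\pm\tfrac{\sqrt{19}}2)$, $f=\bar\partial^4\lambda^3-(2\bar\Delta+3)\bar\partial^3\lambda^4-3\bar\Delta\bar\partial^2\lambda^5-(3\bar\Delta+1)\bar\partial\lambda^6-(\bar\Delta+\tfrac9{28})\lambda^7$; (ii) $\Delta-\bar\Delta=-\tfrac12$, $f=g=0$, $h=a_0$ with $a_0\in\mathbb{C}^*$; (iii) $\Delta-\bar\Delta=\tfrac12$, $f=g=0$, $h=a_0(\bar\partial+2\bar\Delta\lambda)$ with $a_0\in\mathbb{C}^*$; (iv) $(\Delta,\bar\Delta)=(1,-\tfrac12)$, $f=g=0$, $h=a_0(\bar\partial^2-\lambda^2)$ with $a_0\in\mathbb{C}^*$.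
   Context: A Lie conformal algebra is a $\mathbb{C}[\partial]$-module $R$ with a $\lambda$-bracket satisfying conformal sesquilinearity, skew-symmetry and the Jacobi identity; a conformal module over $R$ is a $\mathbb{C}[\partial]$-module $V$ with $a\mapsto a_\lambda\in\mathrm{End}_{\mathbb{C}}(V)\otimes\mathbb{C}[\lambda]$ satisfying $[a_\lambda,b_\mu]=[a_\lambda b]_{\lambda+\mu}$ and $(\partial a)_\lambda=[\partial,a_\lambda]=-\lambda a_\lambda$. $\mathrm{SV}$ is the free $\mathbb{C}[\partial]$-module with basis $L,M,Y$ and nonzero brackets $[L_\lambda L]=(\partial+2\lambda)L$, $[L_\lambda Y]=(\partial+\tfrac32\lambda)Y$, $[L_\lambda M]=(\partial+\lambda)M$, $[Y_\lambda Y]=(\partial+2\lambda)M$. $V(\alpha,\Delta)=\mathbb{C}[\partial]v_\Delta$ with $L_\lambda v_\Delta=(\partial+\alpha+\Delta\lambda)v_\Delta$, $M_\lambda v_\Delta=Y_\lambda v_\Delta=0$. An extension of $W$ by $V$ is an exact sequence $0\to V\to E\to W\to 0$ of conformal modules; equivalence is via a module map of middle terms compatible with identities on $V$ and $W$; trivial means equivalent to the direct sum. *)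

theory Defs
  imports Complex_Main "HOL-Computational_Algebra.Polynomial"
begin

text \<open>
Conventions.
 * The Schroedinger-Virasoro conformal algebra SV is the free C[d]-module on L, M, Y; an
   element P(d)L + Q(d)M + R(d)Y is represented by the triple (P, Q, R) of complex polynomials.
 * The middle term E = C[d]v_bar (+) C[d]v is represented by pairs (p, q) of complex
   polynomials, meaning p(d) v_bar + q(d) v.
 * Polynomials in the two variables d, lambda are elements of complex poly poly:
   the outer variable is lambda, the coefficients are polynomials in d.
 * Since all lambda-dependence is polynomial, lambda-brackets and lambda-actions are
   evaluated at arbitrary complex values of lambda, mu; polynomial identities are
   equivalent to their pointwise versions over the infinite field C.
\<close>

type_synonym sv = "complex poly \<times> complex poly \<times> complex poly"
type_synonym emod = "complex poly \<times> complex poly"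
type_synonym bipoly = "complex poly poly"

definition shift :: "complex \<Rightarrow> complex poly \<Rightarrow> complex poly" where
  "shift z p = pcompose p [:z, 1:]"

definition ev_lam :: "bipoly \<Rightarrow> complex \<Rightarrow> complex poly" where
  "ev_lam f z = poly f [:z:]"

definition sv_add :: "sv \<Rightarrow> sv \<Rightarrow> sv" where
  "sv_add a b = (fst a + fst b, fst (snd a) + fst (snd b), snd (snd a) + snd (snd b))"

definition sv_D :: "sv \<Rightarrow> sv" where
  "sv_D a = ([:0,1:] * fst a, [:0,1:] * fst (snd a), [:0,1:] * snd (snd a))"

text \<open>The lambda-bracket of SV, evaluated at lambda = z. It is determined by
  [L_lambda L] = (d+2 lambda)L, [L_lambda Y] = (d + 3/2 lambda) Y, [L_lambda M] = (d+lambda) M,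
  [Y_lambda Y] = (d + 2 lambda) M, the brackets forced by skew-symmetry
  [Y_lambda L] = (1/2 d + 3/2 lambda) Y, [M_lambda L] = lambda M, all others zero,
  and conformal sesquilinearity [P(d)a_lambda Q(d)b] = P(-lambda) Q(d+lambda) [a_lambda b].\<close>
definition sv_bracket :: "sv \<Rightarrow> sv \<Rightarrow> complex \<Rightarrow> sv" where
  "sv_bracket a b z =
    (let A1 = poly (fst a) (-z); A2 = poly (fst (snd a)) (-z); A3 = poly (snd (snd a)) (-z);
         b1 = shift z (fst b); b2 = shift z (fst (snd b)); b3 = shift z (snd (snd b))
     in ( smult A1 (b1 * [:2*z, 1:]),
          smult A1 (b2 * [:z, 1:]) + smult A2 (b1 * [:z:]) + smult A3 (b3 * [:2*z, 1:]),
          smult A1 (b3 * [:3/2*z, 1:]) + smult A3 (b1 * [:3/2*z, 1/2:]) ))"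

definition e_add :: "emod \<Rightarrow> emod \<Rightarrow> emod" where
  "e_add x y = (fst x + fst y, snd x + snd y)"

definition e_sub :: "emod \<Rightarrow> emod \<Rightarrow> emod" where
  "e_sub x y = (fst x - fst y, snd x - snd y)"

definition e_scale :: "complex \<Rightarrow> emod \<Rightarrow> emod" where
  "e_scale c x = (smult c (fst x), smult c (snd x))"

definition e_D :: "emod \<Rightarrow> emod" where
  "e_D x = ([:0,1:] * fst x, [:0,1:] * snd x)"

text \<open>Actions of the generators at lambda = z on p(d) v_bar + q(d) v, where
  L_lambda v_bar = (d + abar + Dbar lambda) v_bar, M_lambda v_bar = Y_lambda v_bar = 0,
  L_lambda v = (d + a + D lambda) v + f(d,lambda) v_bar, M_lambda v = g(d,lambda) v_bar,
  Y_lambda v = h(d,lambda) v_bar, extended by a_lambda (p(d) w) = p(d+lambda) a_lambda w.\<close>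
definition act_L :: "complex \<Rightarrow> complex \<Rightarrow> complex \<Rightarrow> complex \<Rightarrow> bipoly \<Rightarrow> complex \<Rightarrow> emod \<Rightarrow> emod" where
  "act_L \<alpha> \<alpha>b \<Delta> \<Delta>b f z x =
     (shift z (fst x) * [:\<alpha>b + \<Delta>b * z, 1:] + shift z (snd x) * ev_lam f z,
      shift z (snd x) * [:\<alpha> + \<Delta> * z, 1:])"

definition act_MY :: "bipoly \<Rightarrow> complex \<Rightarrow> emod \<Rightarrow> emod" where
  "act_MY g z x = (shift z (snd x) * ev_lam g z, 0)"

definition act :: "complex \<Rightarrow> complex \<Rightarrow> complex \<Rightarrow> complex \<Rightarrow> bipoly \<times> bipoly \<times> bipoly
                    \<Rightarrow> sv \<Rightarrow> complex \<Rightarrow> emod \<Rightarrow> emod" where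
  "act \<alpha> \<alpha>b \<Delta> \<Delta>b T a z x =
     e_add (e_scale (poly (fst a) (-z)) (act_L \<alpha> \<alpha>b \<Delta> \<Delta>b (fst T) z x))
      (e_add (e_scale (poly (fst (snd a)) (-z)) (act_MY (fst (snd T)) z x))
             (e_scale (poly (snd (snd a)) (-z)) (act_MY (snd (snd T)) z x)))"

definition is_conf_ext :: "complex \<Rightarrow> complex \<Rightarrow> complex \<Rightarrow> complex \<Rightarrow> bipoly \<times> bipoly \<times> bipoly \<Rightarrow> bool" where
  "is_conf_ext \<alpha> \<alpha>b \<Delta> \<Delta>b T \<longleftrightarrow>
     (\<forall>a b z w x. e_sub (act \<alpha> \<alpha>b \<Delta> \<Delta>b T a z (act \<alpha> \<alpha>b \<Delta> \<Delta>b T b w x))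
                         (act \<alpha> \<alpha>b \<Delta> \<Delta>b T b w (act \<alpha> \<alpha>b \<Delta> \<Delta>b T a z x))
                  = act \<alpha> \<alpha>b \<Delta> \<Delta>b T (sv_bracket a b z) (z + w) x) \<and>
     (\<forall>a z x. e_sub (e_D (act \<alpha> \<alpha>b \<Delta> \<Delta>b T a z x)) (act \<alpha> \<alpha>b \<Delta> \<Delta>b T a z (e_D x))
                  = e_scale (-z) (act \<alpha> \<alpha>b \<Delta> \<Delta>b T a z x)) \<and>
     (\<forall>a z x. act \<alpha> \<alpha>b \<Delta> \<Delta>b T (sv_D a) z x = e_scale (-z) (act \<alpha> \<alpha>b \<Delta> \<Delta>b T a z x))"

definition ext_equiv :: "complex \<Rightarrow> complex \<Rightarrow> complex \<Rightarrow> complex \<Rightarrow>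
      bipoly \<times> bipoly \<times> bipoly \<Rightarrow> bipoly \<times> bipoly \<times> bipoly \<Rightarrow> bool" where
  "ext_equiv \<alpha> \<alpha>b \<Delta> \<Delta>b T1 T2 \<longleftrightarrow>
     (\<exists>\<phi> :: emod \<Rightarrow> emod.
        (\<forall>x y. \<phi> (e_add x y) = e_add (\<phi> x) (\<phi> y)) \<and>
        (\<forall>c x. \<phi> (e_scale c x) = e_scale c (\<phi> x)) \<and>
        (\<forall>x. \<phi> (e_D x) = e_D (\<phi> x)) \<and>
        (\<forall>a z x. \<phi> (act \<alpha> \<alpha>b \<Delta> \<Delta>b T1 a z x) = act \<alpha> \<alpha>b \<Delta> \<Delta>b T2 a z (\<phi> x)) \<and>
        (\<forall>p. \<phi> (p, 0) = (p, 0)) \<and>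
        (\<forall>x. snd (\<phi> x) = snd x))"

definition trivial_ext :: "complex \<Rightarrow> complex \<Rightarrow> complex \<Rightarrow> complex \<Rightarrow> bipoly \<times> bipoly \<times> bipoly \<Rightarrow> bool" where
  "trivial_ext \<alpha> \<alpha>b \<Delta> \<Delta>b T \<longleftrightarrow> ext_equiv \<alpha> \<alpha>b \<Delta> \<Delta>b T (0, 0, 0)"

definition bconst :: "complex \<Rightarrow> bipoly" where
  "bconst c = [:[:c:]:]"

definition blam :: bipoly where
  "blam = [:0, 1:]"

definition bdbar :: "complex \<Rightarrow> bipoly" where
  "bdbar \<alpha> = [:[:\<alpha>, 1:]:]"

definition tscale :: "complex \<Rightarrow> bipoly \<times> bipoly \<times> bipoly \<Rightarrow> bipoly \<times> bipoly \<times> bipoly" where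
  "tscale c T = (bconst c * fst T, bconst c * fst (snd T), bconst c * snd (snd T))"

definition sv_list :: "complex \<Rightarrow> complex \<Rightarrow> complex \<Rightarrow> (bipoly \<times> bipoly \<times> bipoly) set" where
  "sv_list \<alpha> \<Delta> \<Delta>b = (let D = bdbar \<alpha>; l = blam in
    {T. (\<Delta> = \<Delta>b \<and> (\<exists>c0 c1. (c0, c1) \<noteq> (0, 0) \<and> T = (bconst c0 + bconst c1 * l, 0, 0)))
      \<or> (\<Delta> - \<Delta>b = 2 \<and> T = (l^2 * (2 * D + l), 0, 0))
      \<or> (\<Delta> - \<Delta>b = 3 \<and> T = (D * l^2 * (D + l), 0, 0))
      \<or> (\<Delta> - \<Delta>b = 4 \<and> T = (l^2 * (4 * D^3 + 6 * D^2 * l - D * l^2 + bconst \<Delta>b * l^3), 0, 0))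
      \<or> (\<Delta> = 1 \<and> \<Delta>b = -4 \<and>
           T = (D^4 * l^2 - 10 * D^2 * l^4 - 17 * D * l^5 - 8 * l^6, 0, 0))
      \<or> (((\<Delta> = 7/2 + of_real (sqrt 19) / 2 \<and> \<Delta>b = -5/2 + of_real (sqrt 19) / 2) \<or>
           (\<Delta> = 7/2 - of_real (sqrt 19) / 2 \<and> \<Delta>b = -5/2 - of_real (sqrt 19) / 2)) \<and>
           T = (D^4 * l^3 - bconst (2 * \<Delta>b + 3) * D^3 * l^4 - bconst (3 * \<Delta>b) * D^2 * l^5
                - bconst (3 * \<Delta>b + 1) * D * l^6 - bconst (\<Delta>b + 9/28) * l^7, 0, 0))
      \<or> (\<Delta> - \<Delta>b = -1/2 \<and> (\<exists>a0. a0 \<noteq> 0 \<and> T = (0, 0, bconst a0)))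
      \<or> (\<Delta> - \<Delta>b = 1/2 \<and> (\<exists>a0. a0 \<noteq> 0 \<and> T = (0, 0, bconst a0 * (D + bconst (2 * \<Delta>b) * l))))
      \<or> (\<Delta> = 1 \<and> \<Delta>b = -1/2 \<and> (\<exists>a0. a0 \<noteq> 0 \<and> T = (0, 0, bconst a0 * (D^2 - l^2))))})"

end

theory Submission
  imports Defs
begin

text \<open>
  Since \<open>[Y, Y]\<close> is a multiple of \<open>M\<close> and \<open>Y\<close> acts nilpotently, \<open>g = 0\<close>, and the conditions on \<open>f\<close> and \<open>h\<close>
  decouple; only \<open>f\<close> can be changed by a coboundary. Putting one parameter to 0 shows that everything
  is trivial unless \<open>\<alpha> = \<alpha>b\<close>, and then one may recentre to \<open>\<alpha> = 0\<close>. The part of the cocycle identity linear in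
  one parameter is an Euler equation: it makes \<open>h\<close> homogeneous of degree \<open>\<Delta> - \<Delta>b + 1/2\<close>, and \<open>f\<close>, up to
  a coboundary, homogeneous of degree \<open>N = \<Delta> - \<Delta>b + 1\<close> (apart from the constants when \<open>\<Delta> = \<Delta>b\<close>).
  The quadratic part is a recursion determining \<open>f\<close> by its coefficients at \<open>\<lambda>\<^sup>2\<close> and \<open>\<lambda>\<^sup>3\<close>; one of them
  is removed by the coboundary of \<open>\<partial>\<^sup>N\<^sup>-\<^sup>1\<close>. For \<open>N \<ge> 6\<close> the coefficient of \<open>\<lambda>\<^sup>3\<mu>\<^sup>4\<close> then forces, unless \<open>T = 0\<close>,
  \<open>T\<^sup>2 = 3 N - 2\<close> with \<open>T = 2 \<Delta>b + N - 2\<close>, and for \<open>N \<ge> 8\<close> the coefficient of \<open>\<lambda>\<^sup>4\<mu>\<^sup>5\<close> contradicts this.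
\<close>

section \<open>Evaluation and coefficients of cocycles\<close>

definition bev :: "bipoly \<Rightarrow> complex \<Rightarrow> complex \<Rightarrow> complex" where
  "bev f x z = poly (ev_lam f z) x"

lemma bev_0 [simp]: "bev 0 x z = 0"
  by (simp add: bev_def ev_lam_def)

lemma bev_pCons [simp]: "bev (pCons c f) x z = poly c x + z * bev f x z"
  by (simp add: bev_def ev_lam_def)

lemma bev_add [simp]: "bev (f + g) x z = bev f x z + bev g x z"
  and bev_diff [simp]: "bev (f - g) x z = bev f x z - bev g x z"
  and bev_mult [simp]: "bev (f * g) x z = bev f x z * bev g x z"
  and bev_power [simp]: "bev (f ^ n) x z = bev f x z ^ n"
  and bev_1 [simp]: "bev 1 x z = 1"
  and bev_numeral [simp]: "bev (numeral k) x z = numeral k"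
  and bev_smult [simp]: "bev (smult p f) x z = poly p x * bev f x z"
  by (simp_all add: bev_def ev_lam_def)

text \<open>Counterpart of \<open>ev_lam\<close>: \<partial> is specialised to \<open>x\<close>, and
  a polynomial in \<lambda> remains.\<close>

definition at_d :: "bipoly \<Rightarrow> complex \<Rightarrow> complex poly" where
  "at_d f x = map_poly (\<lambda>c. poly c x) f"

lemma coeff_at_d [simp]: "coeff (at_d f x) k = poly (coeff f k) x"
  by (simp add: at_d_def coeff_map_poly)

lemma poly_at_d [simp]: "poly (at_d f x) z = bev f x z"
  by (induction f) (simp_all add: at_d_def map_poly_pCons)

lemma poly_ext: "(\<And>x::complex. poly p x = poly q x) \<Longrightarrow> p = q"
  by (simp add: poly_eq_poly_eq_iff [symmetric] fun_eq_iff)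

lemma bipoly_eqI:
  assumes "\<And>x z. bev f x z = bev g x z"
  shows "f = g"
proof (rule poly_eqI)
  fix k
  have "at_d f x = at_d g x" for x
    using assms by (simp add: poly_eq_poly_eq_iff [symmetric] fun_eq_iff)
  then have "poly (coeff f k) x = poly (coeff g k) x" for x
    by (metis coeff_at_d)
  then show "coeff f k = coeff g k"
    by (simp add: poly_eq_poly_eq_iff [symmetric] fun_eq_iff)
qed

text \<open>Rewrites a polynomial in \<partial> as one in \<partial> + \<alpha>. Hence the
  substitution has the opposite sign: f(\<partial>, \<lambda>) is \<open>recentre \<alpha> f\<close>
  taken at (\<partial> + \<alpha>, \<lambda>).\<close>

definition recentre :: "complex \<Rightarrow> bipoly \<Rightarrow> bipoly" where
  "recentre \<alpha> f = map_poly (\<lambda>c. pcompose c [:- \<alpha>, 1:]) f"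

lemma bev_recentre [simp]: "bev (recentre \<alpha> f) x z = bev f (x - \<alpha>) z"
  by (induction f) (simp_all add: recentre_def map_poly_pCons poly_pcompose)

text \<open>The polynomial p(\<partial> + \<lambda>); its coefficients in \<lambda> are the Taylor
  coefficients of \<open>p\<close>.\<close>

definition addvar :: "complex poly \<Rightarrow> bipoly" where
  "addvar p = pcompose (map_poly (\<lambda>c. [:c:]) p) [:[:0, 1:], 1:]"

lemma addvar_0 [simp]: "addvar 0 = 0"
  by (simp add: addvar_def)

lemma addvar_pCons: "addvar (pCons a p) = [:[:a:]:] + [:[:0, 1:], 1:] * addvar p"
  by (simp add: addvar_def map_poly_pCons pcompose_pCons)

lemma bev_addvar [simp]: "bev (addvar p) x z = poly p (x + z)"
  by (induction p) (simp_all add: addvar_pCons algebra_simps)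

lemma coeff_addvar: "coeff (coeff (addvar p) k) n = of_nat (n + k choose k) * coeff p (n + k)"
proof (induction p arbitrary: k n)
  case (pCons a p)
  show ?case
    by (cases k; cases n) (simp_all add: addvar_pCons pCons.IH algebra_simps)
qed simp

lemma coeff_pcompose_shift: "coeff (pcompose p [:x, 1:]) k = poly (coeff (addvar p) k) x"
proof -
  have "at_d (addvar p) x = pcompose p [:x, 1:]"
    by (simp add: poly_eq_poly_eq_iff [symmetric] fun_eq_iff poly_pcompose)
  then show ?thesis
    by (metis coeff_at_d)
qed

lemma coeff_linear_mult:
  "coeff ([:u, v:] * p) k = u * coeff p k + (if k = 0 then 0 else v * coeff p (k - 1))"
  by (cases k) simp_all

text \<open>The Taylor coefficients of a polynomial (its higher derivatives divided by factorials).\<close>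

definition hasse :: "nat \<Rightarrow> complex poly \<Rightarrow> complex poly" where
  "hasse k p = coeff (addvar p) k"

lemma coeff_hasse: "coeff (hasse k p) n = of_nat (n + k choose k) * coeff p (n + k)"
  by (simp add: hasse_def coeff_addvar)

text \<open>Taylor expansion in \<partial> is linear, so it commutes with fixing \<lambda>. This
  reads off the powers of \<open>y\<close> in f(x + y, z).\<close>

lemma hasse_ev_lam: "poly (hasse k (ev_lam f z)) x = bev (map_poly (hasse k) f) x z"
proof (induction f)
  case 0
  show ?case by (simp add: ev_lam_def hasse_def)
next
  case (pCons c f)
  have h0: "hasse k 0 = 0" by (simp add: hasse_def)
  have "hasse k (ev_lam (pCons c f) z) = hasse k c + smult z (hasse k (ev_lam f z))"
    by (rule poly_eqI) (simp add: coeff_hasse ev_lam_def algebra_simps)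
  then show ?case
    by (simp add: map_poly_pCons h0 pCons.IH)
qed

text \<open>The component along v_bar of the bracket relation for \<open>L\<close> and
  \<open>L\<close>, applied to v. The factor \<open>z - w\<close> is \<partial> + 2z at \<partial> =
  -(z + w).\<close>

definition L_cocycle :: "complex \<Rightarrow> complex \<Rightarrow> complex \<Rightarrow> complex \<Rightarrow> bipoly \<Rightarrow> bool" where
  "L_cocycle \<alpha> \<alpha>b \<Delta> \<Delta>b f \<longleftrightarrow> (\<forall>x z w.
     (x + \<alpha>b + \<Delta>b * z) * bev f (x + z) w + (x + z + \<alpha> + \<Delta> * w) * bev f x z
     - (x + \<alpha>b + \<Delta>b * w) * bev f (x + w) z - (x + w + \<alpha> + \<Delta> * z) * bev f x w
     = (z - w) * bev f x (z + w))"

text \<open>The same for the bracket of \<open>L\<close> and \<open>Y\<close>, where \<partial> +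
  3z/2 becomes z/2 - w.\<close>

definition Y_cocycle :: "complex \<Rightarrow> complex \<Rightarrow> complex \<Rightarrow> complex \<Rightarrow> bipoly \<Rightarrow> bool" where
  "Y_cocycle \<alpha> \<alpha>b \<Delta> \<Delta>b h \<longleftrightarrow> (\<forall>x z w.
     (x + \<alpha>b + \<Delta>b * z) * bev h (x + z) w - (x + w + \<alpha> + \<Delta> * z) * bev h x w
     = (z / 2 - w) * bev h x (z + w))"

text \<open>The coefficient of \<open>x\<^sup>p \<lambda>\<^sup>l\<close> in \<open>(x + D \<lambda>) (x + \<lambda>)\<^sup>i\<close>, where \<open>p + l = i + 1\<close> and \<open>l \<ge> 1\<close>
  (for \<open>l = 0\<close> truncated subtraction gives a meaningless value).\<close>

definition bw :: "complex \<Rightarrow> nat \<Rightarrow> nat \<Rightarrow> complex" where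
  "bw D i l = of_nat (i choose l) + D * of_nat (i choose (l - 1))"

abbreviation cf :: "bipoly \<Rightarrow> nat \<Rightarrow> nat \<Rightarrow> complex" where
  "cf f i l \<equiv> coeff (coeff f l) i"

lemma hasse_0 [simp]: "hasse k 0 = 0"
  by (simp add: hasse_def)

text \<open>The coefficient of \<open>x^p z^l w^k\<close> in the cocycle identity. As
  \<open>k\<close> and \<open>l\<close> are positive, the summand (x + z + \<Delta> w) f(x, z)
  contributes only for k = 1, and its mirror image only for l = 1. The coefficients are extracted
  one variable at a time; the facts \<open>w\<close>, \<open>z\<close>, \<open>x\<close> are named
  after the variable in which they are identities of polynomials.\<close>

lemma L_cocycle_coeff:
  assumes coc: "L_cocycle 0 0 \<Delta> D f" and k: "k \<ge> 1" and l: "l \<ge> 1"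
  shows "cf f (p + l - 1) k * bw D (p + l - 1) l + (if k = 1 then \<Delta> * cf f p l else 0)
       - cf f (p + k - 1) l * bw D (p + k - 1) k - (if l = 1 then \<Delta> * cf f p k else 0)
       = cf f p (l + k - 1) * (of_nat (l + k - 1 choose k) - of_nat (l + k - 1 choose l))"
proof -
  have w: "[:x + D * z:] * at_d f (x + z) + [:x + z, \<Delta>:] * [:bev f x z:]
     - [:x, D:] * pcompose (ev_lam f z) [:x, 1:] - [:x + \<Delta> * z, 1:] * at_d f x
     = [:z, -1:] * pcompose (at_d f x) [:z, 1:]" for x z
  proof (rule poly_ext)
    fix y
    show "poly ([:x + D * z:] * at_d f (x + z) + [:x + z, \<Delta>:] * [:bev f x z:]
       - [:x, D:] * pcompose (ev_lam f z) [:x, 1:] - [:x + \<Delta> * z, 1:] * at_d f x) y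
       = poly ([:z, -1:] * pcompose (at_d f x) [:z, 1:]) y"
      using coc [unfolded L_cocycle_def, rule_format, of x z y]
      by (simp add: poly_pcompose algebra_simps flip: bev_def)
  qed
  have k0: "k \<noteq> 0" "l \<noteq> 0" using k l by auto
  have w1: "(x + D * z) * poly (coeff f k) (x + z) + (if k = 1 then \<Delta> * bev f x z else 0)
     - x * bev (map_poly (hasse k) f) x z - D * bev (map_poly (hasse (k-1)) f) x z
     - (x + \<Delta> * z) * poly (coeff f k) x - poly (coeff f (k-1)) x
     = z * poly (hasse k (at_d f x)) z - poly (hasse (k-1) (at_d f x)) z" for x z
    using arg_cong [OF w [of x z], of "\<lambda>q. coeff q k"] k0
    by (cases k) (auto simp add: coeff_linear_mult coeff_pcompose_shift coeff_pCons hasse_ev_lam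
         algebra_simps simp flip: hasse_def split: nat.splits)
  have z: "[:x, D:] * pcompose (coeff f k) [:x, 1:] + smult (if k = 1 then \<Delta> else 0) (at_d f x)
     - smult x (at_d (map_poly (hasse k) f) x) - smult D (at_d (map_poly (hasse (k-1)) f) x)
     - [:x, \<Delta>:] * [:poly (coeff f k) x:] - [:poly (coeff f (k-1)) x:]
     = [:0,1:] * hasse k (at_d f x) - hasse (k-1) (at_d f x)" for x
  proof (rule poly_ext)
    fix y
    show "poly ([:x, D:] * pcompose (coeff f k) [:x, 1:] + smult (if k = 1 then \<Delta> else 0) (at_d f x)
     - smult x (at_d (map_poly (hasse k) f) x) - smult D (at_d (map_poly (hasse (k-1)) f) x)
     - [:x, \<Delta>:] * [:poly (coeff f k) x:] - [:poly (coeff f (k-1)) x:]) y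
     = poly ([:0,1:] * hasse k (at_d f x) - hasse (k-1) (at_d f x)) y"
      using w1 [of x y] by (simp add: poly_pcompose algebra_simps split: if_splits)
  qed
  have z1: "x * poly (hasse l (coeff f k)) x + D * poly (hasse (l-1) (coeff f k)) x
     + (if k = 1 then \<Delta> else 0) * poly (coeff f l) x
     - x * poly (hasse k (coeff f l)) x - D * poly (hasse (k-1) (coeff f l)) x
     - (if l = 1 then \<Delta> else 0) * poly (coeff f k) x
     = (of_nat (l + k - 1 choose k) - of_nat (l + k - 1 choose l)) * poly (coeff f (l + k - 1)) x" for x
  proof -
    have "l + k - 1 choose l = (l + k - 1 choose (k - 1))"
      using binomial_symmetric [of l "l + k - 1"] k0 by simp
    then show ?thesis
      using arg_cong [OF z [of x], of "\<lambda>q. coeff q l"] k0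
      by (cases l; cases k)
        (auto simp add: coeff_linear_mult coeff_pcompose_shift coeff_pCons coeff_hasse coeff_map_poly
          algebra_simps simp flip: hasse_def split: nat.splits)
  qed
  have x: "[:0,1:] * hasse l (coeff f k) + smult D (hasse (l-1) (coeff f k))
     + smult (if k = 1 then \<Delta> else 0) (coeff f l)
     - [:0,1:] * hasse k (coeff f l) - smult D (hasse (k-1) (coeff f l))
     - smult (if l = 1 then \<Delta> else 0) (coeff f k)
     = smult (of_nat (l + k - 1 choose k) - of_nat (l + k - 1 choose l)) (coeff f (l + k - 1))"
    using z1 unfolding poly_eq_poly_eq_iff [symmetric] fun_eq_iff by auto
  show ?thesis
    using arg_cong [OF x, of "\<lambda>q. coeff q p"] k0
    by (cases l; cases k; cases p)
       (auto simp add: coeff_linear_mult coeff_hasse bw_def binomial_eq_0 algebra_simps)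
qed

text \<open>Again the coefficient of \<open>x^p z^l w^k\<close>, extracted in the order
  \<open>z\<close>, \<open>w\<close>, \<open>x\<close>. Here k = 0 is allowed; that case will
  express every coefficient of \<open>h\<close> through one of them.\<close>

lemma Y_cocycle_coeff:
  assumes coc: "Y_cocycle 0 0 \<Delta> D h" and l: "l \<ge> 1"
  shows "cf h (p + l - 1) k * bw D (p + l - 1) l - (if l = 1 then \<Delta> * cf h p k else 0)
       = cf h p (l + k - 1) * (of_nat (l + k - 1 choose k) / 2 - of_nat (l + k - 1 choose l))"
proof -
  have l0: "l \<noteq> 0" using l by auto
  have z: "[:x, D:] * pcompose (ev_lam h w) [:x, 1:] - [:x + w, \<Delta>:] * [:bev h x w:]
     = [:- w, 1/2:] * pcompose (at_d h x) [:w, 1:]" for x w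
  proof (rule poly_ext)
    fix y
    show "poly ([:x, D:] * pcompose (ev_lam h w) [:x, 1:] - [:x + w, \<Delta>:] * [:bev h x w:]) y
        = poly ([:- w, 1/2:] * pcompose (at_d h x) [:w, 1:]) y"
      using coc [unfolded Y_cocycle_def, rule_format, of x y w]
      by (simp add: poly_pcompose algebra_simps flip: bev_def)
  qed
  have z1: "x * bev (map_poly (hasse l) h) x w + D * bev (map_poly (hasse (l-1)) h) x w
     - (if l = 1 then \<Delta> * bev h x w else 0)
     = - w * poly (hasse l (at_d h x)) w + poly (hasse (l-1) (at_d h x)) w / 2" for x w
    using arg_cong [OF z [of x w], of "\<lambda>q. coeff q l"] l0
    by (cases l) (auto simp add: coeff_linear_mult coeff_pcompose_shift coeff_pCons hasse_ev_lam
         algebra_simps simp flip: hasse_def split: nat.splits)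
  have w: "smult x (at_d (map_poly (hasse l) h) x) + smult D (at_d (map_poly (hasse (l-1)) h) x)
     - smult (if l = 1 then \<Delta> else 0) (at_d h x)
     = [:0, -1:] * hasse l (at_d h x) + smult (1/2) (hasse (l-1) (at_d h x))" for x
  proof (rule poly_ext)
    fix y
    show "poly (smult x (at_d (map_poly (hasse l) h) x) + smult D (at_d (map_poly (hasse (l-1)) h) x)
     - smult (if l = 1 then \<Delta> else 0) (at_d h x)) y
     = poly ([:0, -1:] * hasse l (at_d h x) + smult (1/2) (hasse (l-1) (at_d h x))) y"
      using z1 [of x y] by (simp add: poly_pcompose algebra_simps split: if_splits)
  qed
  have w1: "x * poly (hasse l (coeff h k)) x + D * poly (hasse (l-1) (coeff h k)) x
     - (if l = 1 then \<Delta> else 0) * poly (coeff h k) x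
     = (of_nat (l + k - 1 choose k) / 2 - of_nat (l + k - 1 choose l)) * poly (coeff h (l + k - 1)) x" for x
  proof -
    have "l + k - 1 choose k = (l + k - 1 choose (l - 1))"
      using binomial_symmetric [of k "l + k - 1"] l0 by simp
    then show ?thesis
      using arg_cong [OF w [of x], of "\<lambda>q. coeff q k"] l0
      by (cases l; cases k)
        (auto simp add: coeff_linear_mult coeff_pCons coeff_hasse coeff_map_poly binomial_eq_0
          algebra_simps simp flip: hasse_def split: nat.splits)
  qed
  have x: "[:0,1:] * hasse l (coeff h k) + smult D (hasse (l-1) (coeff h k))
     - smult (if l = 1 then \<Delta> else 0) (coeff h k)
     = smult (of_nat (l + k - 1 choose k) / 2 - of_nat (l + k - 1 choose l)) (coeff h (l + k - 1))"
    using w1 by (auto intro!: poly_ext)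
  show ?thesis
    using arg_cong [OF x, of "\<lambda>q. coeff q p"] l0
    by (cases l; cases k; cases p)
       (auto simp add: coeff_linear_mult coeff_hasse bw_def binomial_eq_0 algebra_simps)
qed

section \<open>Extensions and equivalences as pointwise identities\<close>

lemma poly_shift [simp]: "poly (shift z p) x = poly p (x + z)"
  by (simp add: shift_def poly_pcompose add.commute)

lemma shift_0 [simp]: "shift z 0 = 0"
  and shift_1 [simp]: "shift z 1 = 1"
  by (simp_all add: shift_def pcompose_1)

lemma emod_eqI:
  assumes "\<And>t. poly (fst x) t = poly (fst y) t" "\<And>t. poly (snd x) t = poly (snd y) t"
  shows "(x :: emod) = y"
  using assms by (auto intro!: prod_eqI poly_ext)

lemma act_fst: "poly (fst (act \<alpha> \<alpha>b \<Delta> \<Delta>b (f, g, h) a z x)) t =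
   poly (fst a) (-z) * (poly (fst x) (t + z) * (t + \<alpha>b + \<Delta>b * z) + poly (snd x) (t + z) * bev f t z)
   + poly (fst (snd a)) (-z) * (poly (snd x) (t + z) * bev g t z)
   + poly (snd (snd a)) (-z) * (poly (snd x) (t + z) * bev h t z)"
  by (simp add: act_def act_L_def act_MY_def e_add_def e_scale_def bev_def algebra_simps)

lemma act_snd: "poly (snd (act \<alpha> \<alpha>b \<Delta> \<Delta>b (f, g, h) a z x)) t =
   poly (fst a) (-z) * (poly (snd x) (t + z) * (t + \<alpha> + \<Delta> * z))"
  by (simp add: act_def act_L_def act_MY_def e_add_def e_scale_def algebra_simps)

lemmas emod_simps = act_fst act_snd e_add_def e_sub_def e_scale_def e_D_def

text \<open>The bracket relations of the generators are applied to v. As \<open>Y\<close> maps v to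
  multiples of v_bar, which it kills, [Y, Y] acts by 0 on v, and this forces g = 0.\<close>

lemma is_conf_ext_D:
  assumes "is_conf_ext \<alpha> \<alpha>b \<Delta> \<Delta>b (f, g, h)"
  shows "g = 0" "L_cocycle \<alpha> \<alpha>b \<Delta> \<Delta>b f" "Y_cocycle \<alpha> \<alpha>b \<Delta> \<Delta>b h"
proof -
  define v where "v = ((0, 1) :: emod)"
  have br: "poly (fst (e_sub (act \<alpha> \<alpha>b \<Delta> \<Delta>b (f, g, h) a z (act \<alpha> \<alpha>b \<Delta> \<Delta>b (f, g, h) b w v))
                   (act \<alpha> \<alpha>b \<Delta> \<Delta>b (f, g, h) b w (act \<alpha> \<alpha>b \<Delta> \<Delta>b (f, g, h) a z v)))) x
            = poly (fst (act \<alpha> \<alpha>b \<Delta> \<Delta>b (f, g, h) (sv_bracket a b z) (z + w) v)) x" for a b z w x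
    using assms [unfolded is_conf_ext_def, THEN conjunct1, rule_format, of a z b w v] by (rule arg_cong)
  have g: "(z - w) * bev g x (z + w) = 0" for x z w
    using br [of "(0, 0, 1)" z "(0, 0, 1)" w x]
    by (auto simp add: emod_simps sv_bracket_def v_def Let_def algebra_simps)
  \<comment> \<open>The argument \<open>z\<close> has to be split into two unequal summands: z + 0
    if z is nonzero, and 1 + (-1) if z = 0.\<close>
  have "bev g x z = 0" for x z
    using g [of "z + 1" "-1" x] g [of z 0 x] by (cases "z = 0") simp_all
  then show "g = 0"
    by (intro bipoly_eqI) simp
  show "L_cocycle \<alpha> \<alpha>b \<Delta> \<Delta>b f"
    unfolding L_cocycle_def
  proof (intro allI)
    fix x z w
    show "(x + \<alpha>b + \<Delta>b * z) * bev f (x + z) w + (x + z + \<alpha> + \<Delta> * w) * bev f x z -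
       (x + \<alpha>b + \<Delta>b * w) * bev f (x + w) z - (x + w + \<alpha> + \<Delta> * z) * bev f x w =
       (z - w) * bev f x (z + w)"
      using br [of "(1, 0, 0)" z "(1, 0, 0)" w x]
      by (simp add: emod_simps sv_bracket_def v_def Let_def algebra_simps)
  qed
  show "Y_cocycle \<alpha> \<alpha>b \<Delta> \<Delta>b h"
    unfolding Y_cocycle_def
  proof (intro allI)
    fix x z w
    show "(x + \<alpha>b + \<Delta>b * z) * bev h (x + z) w - (x + w + \<alpha> + \<Delta> * z) * bev h x w =
       (z / 2 - w) * bev h x (z + w)"
      using br [of "(1, 0, 0)" z "(0, 0, 1)" w x]
      by (simp add: emod_simps sv_bracket_def v_def Let_def algebra_simps)
  qed
qed

lemma is_conf_ext_I:
  assumes f: "L_cocycle \<alpha> \<alpha>b \<Delta> \<Delta>b f" and h: "Y_cocycle \<alpha> \<alpha>b \<Delta> \<Delta>b h"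
  shows "is_conf_ext \<alpha> \<alpha>b \<Delta> \<Delta>b (f, 0, h)"
proof -
  have "e_sub (act \<alpha> \<alpha>b \<Delta> \<Delta>b (f, 0, h) a z (act \<alpha> \<alpha>b \<Delta> \<Delta>b (f, 0, h) b w x))
              (act \<alpha> \<alpha>b \<Delta> \<Delta>b (f, 0, h) b w (act \<alpha> \<alpha>b \<Delta> \<Delta>b (f, 0, h) a z x))
        = act \<alpha> \<alpha>b \<Delta> \<Delta>b (f, 0, h) (sv_bracket a b z) (z + w) x" (is "?l = ?r") for a b z w x
  proof (rule emod_eqI)
    fix t
    obtain A1 A2 A3 B1 B2 B3 p q where a: "a = (A1, A2, A3)" "b = (B1, B2, B3)" "x = (p, q)"
      by (metis prod.collapse)
    have sub: "t + z + w = t + (z + w)" "t + w + z = t + (z + w)" "- (z + w) + z = - w" "- z - w + z = - w"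
      by simp_all
    define s where "s = poly q (t + (z + w))"
    define \<A> where "\<A> = poly A1 (-z)"
    define \<B> where "\<B> = poly B1 (-w)"
    define \<A>' where "\<A>' = poly A3 (-z)"
    define \<B>' where "\<B>' = poly B3 (-w)"
    note f' = f [unfolded L_cocycle_def, rule_format, of t z w]
    note h1 = h [unfolded Y_cocycle_def, rule_format, of t z w]
    note h2 = h [unfolded Y_cocycle_def, rule_format, of t w z, unfolded add.commute [of w z]]
    \<comment> \<open>By sesquilinearity only the pairs (L, L), (L, Y) and (Y, L) of generators
      contribute, each through its cocycle identity times values of the coefficients;
      \<open>M\<close> acts by 0, and so does any product of two actions of
      \<open>Y\<close>.\<close>
    have "poly (fst ?l) t - poly (fst ?r) t =
       \<A> * \<B> * s * ((t + \<alpha>b + \<Delta>b * z) * bev f (t + z) w + (t + z + \<alpha> + \<Delta> * w) * bev f t z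
         - (t + \<alpha>b + \<Delta>b * w) * bev f (t + w) z - (t + w + \<alpha> + \<Delta> * z) * bev f t w
         - (z - w) * bev f t (z + w))
       + \<A> * \<B>' * s * ((t + \<alpha>b + \<Delta>b * z) * bev h (t + z) w - (t + w + \<alpha> + \<Delta> * z) * bev h t w
         - (z / 2 - w) * bev h t (z + w))
       - \<A>' * \<B> * s * ((t + \<alpha>b + \<Delta>b * w) * bev h (t + w) z - (t + z + \<alpha> + \<Delta> * w) * bev h t z
         - (w / 2 - z) * bev h t (z + w))"
      unfolding a by (simp add: emod_simps sv_bracket_def Let_def sub flip: s_def \<A>_def \<B>_def \<A>'_def \<B>'_def)
         (simp add: field_simps)
    also have "\<dots> = 0"
      using f' h1 h2 by simp
    finally show "poly (fst ?l) t = poly (fst ?r) t"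
      by simp
    show "poly (snd ?l) t = poly (snd ?r) t"
      unfolding a by (simp add: emod_simps sv_bracket_def Let_def sub flip: s_def \<A>_def \<B>_def \<A>'_def \<B>'_def)
         (simp add: algebra_simps)
  qed
  moreover have "e_sub (e_D (act \<alpha> \<alpha>b \<Delta> \<Delta>b (f, 0, h) a z x)) (act \<alpha> \<alpha>b \<Delta> \<Delta>b (f, 0, h) a z (e_D x))
      = e_scale (- z) (act \<alpha> \<alpha>b \<Delta> \<Delta>b (f, 0, h) a z x)" for a z x
    by (rule emod_eqI) (simp_all add: emod_simps algebra_simps)
  moreover have "act \<alpha> \<alpha>b \<Delta> \<Delta>b (f, 0, h) (sv_D a) z x
      = e_scale (- z) (act \<alpha> \<alpha>b \<Delta> \<Delta>b (f, 0, h) a z x)" for a z x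
    by (rule emod_eqI) (simp_all add: emod_simps sv_D_def algebra_simps)
  ultimately show ?thesis
    unfolding is_conf_ext_def by blast
qed

text \<open>The change of \<open>f\<close> under the equivalence that sends v to v + p(\<partial>)
  v_bar.\<close>

definition L_coboundary :: "complex \<Rightarrow> complex \<Rightarrow> complex \<Rightarrow> complex \<Rightarrow> complex poly \<Rightarrow> complex \<Rightarrow> complex \<Rightarrow> complex" where
  "L_coboundary \<alpha> \<alpha>b \<Delta> \<Delta>b p x z =
     (x + \<alpha> + \<Delta> * z) * poly p x - (x + \<alpha>b + \<Delta>b * z) * poly p (x + z)"

text \<open>An equivalence is determined by the component \<open>p\<close> of the image of v along
  v_bar. It cannot change \<open>h\<close>, because \<open>Y\<close> kills v_bar.\<close>

lemma ext_equiv_D: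
  assumes "ext_equiv \<alpha> \<alpha>b \<Delta> \<Delta>b (f1, g1, h1) (f2, g2, h2)"
  shows "h1 = h2" "\<exists>p. \<forall>x z. bev f2 x z = bev f1 x z + L_coboundary \<alpha> \<alpha>b \<Delta> \<Delta>b p x z"
proof -
  obtain \<phi> where add: "\<And>x y. \<phi> (e_add x y) = e_add (\<phi> x) (\<phi> y)"
    and scale: "\<And>c x. \<phi> (e_scale c x) = e_scale c (\<phi> x)"
    and D: "\<And>x. \<phi> (e_D x) = e_D (\<phi> x)"
    and act: "\<And>a z x. \<phi> (act \<alpha> \<alpha>b \<Delta> \<Delta>b (f1, g1, h1) a z x) = act \<alpha> \<alpha>b \<Delta> \<Delta>b (f2, g2, h2) a z (\<phi> x)"
    and sub: "\<And>p. \<phi> (p, 0) = (p, 0)" and quot: "\<And>x. snd (\<phi> x) = snd x"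
    using assms unfolding ext_equiv_def by metis
  define p where "p = fst (\<phi> (0, 1))"
  have v: "\<phi> (0, 1) = (p, 1)"
    using quot [of "(0, 1)"] by (simp add: p_def prod_eq_iff)
  have "ev_lam h1 z = ev_lam h2 z" for z
  proof -
    have "act \<alpha> \<alpha>b \<Delta> \<Delta>b (f1, g1, h1) (0, 0, 1) z (0, 1) = (ev_lam h1 z, 0)"
      by (simp add: act_def act_L_def act_MY_def e_add_def e_scale_def)
    moreover have "act \<alpha> \<alpha>b \<Delta> \<Delta>b (f2, g2, h2) (0, 0, 1) z (p, 1) = (ev_lam h2 z, 0)"
      by (simp add: act_def act_L_def act_MY_def e_add_def e_scale_def)
    ultimately show ?thesis
      using act [of "(0, 0, 1)" z "(0, 1)"] sub v by simp
  qed
  then show "h1 = h2"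
    by (intro bipoly_eqI) (simp add: bev_def)
  have "bev f2 x z = bev f1 x z + L_coboundary \<alpha> \<alpha>b \<Delta> \<Delta>b p x z" for x z
  proof -
    \<comment> \<open>The action of \<open>L\<close> on v yields a multiple of v_bar plus
      (\<partial> + c) v, so additivity, scalars and one application of \<partial> give its
      image.\<close>
    have lin: "\<phi> (q, [:c, 1:]) = e_add (q, 0) (e_add (e_D (p, 1)) (e_scale c (p, 1)))" for q c
    proof -
      have "(q, [:c, 1:]) = e_add (q, 0) (e_add (e_D (0, 1)) (e_scale c (0, 1)))"
        by (simp add: e_add_def e_D_def e_scale_def)
      then show ?thesis
        using add D scale sub v by simp
    qed
    have "act \<alpha> \<alpha>b \<Delta> \<Delta>b (f1, g1, h1) (1, 0, 0) z (0, 1) = (ev_lam f1 z, [:\<alpha> + \<Delta> * z, 1:])"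
      by (simp add: act_def act_L_def act_MY_def e_add_def e_scale_def)
    then have "poly (fst (e_add (ev_lam f1 z, 0) (e_add (e_D (p, 1)) (e_scale (\<alpha> + \<Delta> * z) (p, 1))))) x
       = poly (fst (act \<alpha> \<alpha>b \<Delta> \<Delta>b (f2, g2, h2) (1, 0, 0) z (p, 1))) x"
      using act [of "(1, 0, 0)" z "(0, 1)"] lin v by simp
    then show ?thesis
      by (simp add: emod_simps L_coboundary_def algebra_simps flip: bev_def)
  qed
  then show "\<exists>p. \<forall>x z. bev f2 x z = bev f1 x z + L_coboundary \<alpha> \<alpha>b \<Delta> \<Delta>b p x z"
    by blast
qed

lemma ext_equiv_I:
  assumes p: "\<And>x z. bev f2 x z = bev f1 x z + L_coboundary \<alpha> \<alpha>b \<Delta> \<Delta>b p x z"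
  shows "ext_equiv \<alpha> \<alpha>b \<Delta> \<Delta>b (f1, g, h) (f2, g, h)"
  unfolding ext_equiv_def
  by (rule exI [of _ "\<lambda>x. (fst x + p * snd x, snd x)"])
     (intro conjI allI emod_eqI; simp add: emod_simps p L_coboundary_def algebra_simps)

section \<open>Cocycles for the generator Y\<close>

lemma of_nat_choose_Suc:
  "(of_nat (n choose Suc k) :: complex) = (of_nat n - of_nat k) * of_nat (n choose k) / (of_nat k + 1)"
proof -
  have "(of_nat k + 1 :: complex) \<noteq> 0"
    by (metis of_nat_Suc of_nat_neq_0 add.commute)
  then show ?thesis
    using gbinomial_mult_1 [of "of_nat n :: complex" k]
    by (simp add: binomial_gbinomial field_simps)
qed

lemma of_nat_choose:
  fixes n :: nat
  defines "\<nu> \<equiv> of_nat n :: complex"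
  shows of_nat_choose_2: "of_nat (n choose 2) = \<nu> * (\<nu> - 1) / 2"
    and of_nat_choose_3: "of_nat (n choose 3) = \<nu> * (\<nu> - 1) * (\<nu> - 2) / 6"
    and of_nat_choose_4: "of_nat (n choose 4) = \<nu> * (\<nu> - 1) * (\<nu> - 2) * (\<nu> - 3) / 24"
    and of_nat_choose_5: "of_nat (n choose 5) = \<nu> * (\<nu> - 1) * (\<nu> - 2) * (\<nu> - 3) * (\<nu> - 4) / 120"
proof -
  show 2: "of_nat (n choose 2) = \<nu> * (\<nu> - 1) / 2"
    using of_nat_choose_Suc [of n 1] by (simp add: \<nu>_def numeral_2_eq_2)
  show 3: "of_nat (n choose 3) = \<nu> * (\<nu> - 1) * (\<nu> - 2) / 6"
    using of_nat_choose_Suc [of n 2] 2 by (simp add: \<nu>_def)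
  show 4: "of_nat (n choose 4) = \<nu> * (\<nu> - 1) * (\<nu> - 2) * (\<nu> - 3) / 24"
    using of_nat_choose_Suc [of n 3] 3 by (simp add: \<nu>_def)
  show "of_nat (n choose 5) = \<nu> * (\<nu> - 1) * (\<nu> - 2) * (\<nu> - 3) * (\<nu> - 4) / 120"
    using of_nat_choose_Suc [of n 4] 4 by (simp add: \<nu>_def)
qed

lemma bw_simps:
  fixes n :: nat
  defines "\<nu> \<equiv> of_nat n :: complex"
  shows bw_1: "bw D n 1 = \<nu> + D"
    and bw_2: "bw D n 2 = \<nu> * ((\<nu> - 1) / 2 + D)"
    and bw_3: "bw D n 3 = \<nu> * (\<nu> - 1) / 2 * ((\<nu> - 2) / 3 + D)"
    and bw_4: "bw D n 4 = \<nu> * (\<nu> - 1) * (\<nu> - 2) / 6 * ((\<nu> - 3) / 4 + D)"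
  by (simp_all add: bw_def of_nat_choose flip: \<nu>_def) (simp_all add: field_simps)

text \<open>The homogeneous polynomial of degree \<open>length xs - 1\<close> in which entry
  \<open>l\<close> of the list belongs to \<open>\<lambda>^l\<close>.\<close>

definition homp :: "complex list \<Rightarrow> bipoly" where
  "homp xs = (\<Sum>l<length xs. monom (monom (xs ! l) (length xs - 1 - l)) l)"

lemma bev_sum: "bev (\<Sum>i\<in>A. f i) x z = (\<Sum>i\<in>A. bev (f i) x z)"
  by (induction A rule: infinite_finite_induct) simp_all

lemma bev_monom: "bev (monom p l) x z = poly p x * z ^ l"
  by (simp add: bev_def ev_lam_def poly_monom)

lemma bev_homp: "bev (homp xs) x z = (\<Sum>l<length xs. xs ! l * x ^ (length xs - 1 - l) * z ^ l)"
  by (simp add: homp_def bev_sum bev_monom poly_monom)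

lemma cf_homp: "cf (homp xs) i l = (if i + l + 1 = length xs then xs ! l else 0)"
proof -
  have "cf (homp xs) i l = (\<Sum>j<length xs. if j = l then (if length xs - 1 - j = i then xs ! j else 0) else 0)"
    unfolding homp_def coeff_sum
    by (rule sum.cong) (auto simp: coeff_monom)
  then show ?thesis
    by (auto simp: sum.delta)
qed

lemma homp_eqI:
  assumes "\<And>i l. cf r i l \<noteq> 0 \<Longrightarrow> i + l + 1 = length xs"
    and "\<And>l. l < length xs \<Longrightarrow> cf r (length xs - 1 - l) l = xs ! l"
  shows "r = homp xs"
proof (intro poly_eqI)
  fix l i
  show "cf r i l = cf (homp xs) i l"
  proof (cases "i + l + 1 = length xs")
    case True
    then have "i = length xs - 1 - l" "l < length xs" by linarith+
    then show ?thesis using assms(2) [of l] True by (simp add: cf_homp)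
  qed (use assms(1) [of l i] in \<open>auto simp: cf_homp\<close>)
qed

text \<open>The part linear in \<open>z\<close> is an Euler equation and fixes the degree
  \<open>m\<close>. The equations with k = 0 express all coefficients through that of
  \<open>\<partial>^m\<close>; then (l, k) = (2, 1) restricts \<open>D\<close>, and (2, 2) forces m
  < 3.\<close>

lemma Y_cocycle_classification:
  assumes coc: "Y_cocycle 0 0 \<Delta> D h" and "h \<noteq> 0" and "D \<noteq> 0"
  shows "\<exists>a. a \<noteq> 0 \<and>
     ((\<Delta> - D = -1/2 \<and> h = homp [a])
    \<or> (\<Delta> - D = 1/2 \<and> h = homp [a, a * (2 * D)])
    \<or> (\<Delta> = 1 \<and> D = -1/2 \<and> h = homp [a, 0, -a]))"
proof -
  note eq = Y_cocycle_coeff [OF coc]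
  have deg: "\<Delta> = D + of_nat (i + k) - 1/2" if "cf h i k \<noteq> 0" for i k
  proof -
    have "cf h i k * (of_nat i + D) - \<Delta> * cf h i k = cf h i k * (1 / 2 - of_nat k)"
      using eq [of 1 k i] by (simp add: bw_def)
    then have "cf h i k * (of_nat i + D - \<Delta> - 1/2 + of_nat k) = 0"
      by algebra
    with that have "of_nat i + D - \<Delta> - 1/2 + of_nat k = 0" by simp
    then show ?thesis by (simp add: algebra_simps)
  qed
  obtain i0 k0 where ik: "cf h i0 k0 \<noteq> 0"
    using \<open>h \<noteq> 0\<close> by (metis coeff_0 poly_eqI)
  define m where "m = i0 + k0"
  define M where "M = (of_nat m :: complex)"
  have \<Delta>: "\<Delta> = D + M - 1/2"
    using deg [OF ik] by (simp add: m_def M_def)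
  have hom: "i + k = m" if "cf h i k \<noteq> 0" for i k
    using deg [OF that] \<Delta> by (simp add: M_def) (metis of_nat_add of_nat_eq_iff)
  define a where "a = cf h m 0"
  \<comment> \<open>In the equation with l = j + 1 and k = 0 the factor on the right is 1/2.\<close>
  have aj: "cf h (m - j) j = 2 * a * bw D m (Suc j)" if "1 \<le> j" "j \<le> m" for j
    using eq [of "Suc j" 0 "m - j"] that by (simp add: a_def binomial_eq_0 mult_ac)
  have a: "a \<noteq> 0"
  proof
    assume "a = 0"
    then show False
      using ik aj [of k0] by (cases "k0 = 0") (auto simp: m_def a_def)
  qed
  have a1: "cf h (m - 1) 1 = 2 * a * bw D m 2" if "m \<ge> 1"
    using aj [of 1] that by (simp add: numeral_2_eq_2)
  have a2: "cf h (m - 2) 2 = 2 * a * bw D m 3" if "m \<ge> 2"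
    using aj [of 2] that by (simp add: numeral_3_eq_3 numeral_2_eq_2)
  have a3: "cf h (m - 3) 3 = 2 * a * bw D m 4" if "m \<ge> 3"
    using aj [of 3] that by (simp add: numeral_3_eq_3 eval_nat_numeral)
  \<comment> \<open>For l = 2, k = 1 the factor 2/2 - 1 on the right vanishes.\<close>
  have e1: "cf h (m - 1) 1 * bw D (m - 1) 2 = 0" if "m \<ge> 2"
    using eq [of 2 1 "m - 2"] that by (simp add: Suc_diff_Suc numeral_2_eq_2)
  have M1: "of_nat (m - 1) = M - 1" if "m \<ge> 2"
    using that by (simp add: M_def of_nat_diff)
  have Mne: "M \<noteq> 0" "M \<noteq> 1" if "m \<ge> 2"
    using that by (auto simp: M_def)
  have D2: "2 * D = 1 - M \<or> 2 * D = 2 - M" if "m \<ge> 2"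
  proof -
    have "4 * (cf h (m - 1) 1 * bw D (m - 1) 2) = 2 * a * M * (M - 1) * (M - 1 + 2 * D) * (M - 2 + 2 * D)"
      using that M1 [OF that] unfolding a1 [OF order_trans [OF one_le_numeral that]] bw_2
      by (simp add: M_def field_simps)
    then have "(M - 1 + 2 * D) * (M - 2 + 2 * D) = 0"
      using e1 [OF that] a Mne [OF that] by auto
    then have "M - 1 + 2 * D = 0 \<or> M - 2 + 2 * D = 0"
      by simp
    then show ?thesis
      by (elim disjE) algebra+
  qed
  have "m < 3"
  proof (rule ccontr)
    assume "\<not> m < 3"
    then have m: "m \<ge> 3" "m \<ge> 2" by auto
    have M2: "of_nat (m - 2) = M - 2"
      using m by (simp add: M_def of_nat_diff)
    have "M = 2 \<longleftrightarrow> m = 2"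
      unfolding M_def by (metis of_nat_eq_iff of_nat_numeral)
    then have "M \<noteq> 2"
      using m by simp
    have "M + 1 = of_nat (Suc m)"
      by (simp add: M_def)
    then have "M + 1 \<noteq> 0"
      by (metis of_nat_neq_0)
    have "cf h (m - 2) 2 * bw D (m - 2) 2 = cf h (m - 3) 3 * (3 / 2 - 3)"
      using eq [of 2 2 "m - 3"] m by (simp add: numeral_eq_Suc Suc_diff_Suc)
    then have e: "2 * a * bw D m 3 * bw D (m - 2) 2 = 2 * a * bw D m 4 * (3 / 2 - 3)"
      using a2 a3 m by simp
    \<comment> \<open>For either value of \<open>D\<close>, equation (2, 2) collapses to this
      product, all of whose factors are nonzero for m \<ge> 3.\<close>
    have "a * (M * (M - 1) * (M - 2) * (M + 1)) = 0"
      using D2 [OF m(2)]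
    proof
      assume "2 * D = 1 - M"
      then have D: "D = (1 - M) / 2" by (simp add: field_simps)
      show ?thesis
        using e unfolding bw_2 bw_3 bw_4 D M2 M_def [symmetric] by (simp add: field_simps) algebra
    next
      assume "2 * D = 2 - M"
      then have D: "D = (2 - M) / 2" by (simp add: field_simps)
      show ?thesis
        using e unfolding bw_2 bw_3 bw_4 D M2 M_def [symmetric] by (simp add: field_simps) algebra
    qed
    then show False
      using a Mne m \<open>M \<noteq> 2\<close> \<open>M + 1 \<noteq> 0\<close> by simp
  qed
  then consider "m = 0" | "m = 1" | "m = 2" by linarith
  then show ?thesis
  proof cases
    case 1
    then have "h = homp [a]"
      using hom by (intro homp_eqI) (auto simp: a_def)
    then show ?thesis using 1 a \<Delta> by (auto simp: M_def)
  next
    case 2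
    then have "h = homp [a, a * (2 * D)]"
      using hom a1 by (intro homp_eqI) (auto simp: a_def bw_2 less_Suc_eq nth_Cons')
    then show ?thesis using 2 a \<Delta> by (auto simp: M_def)
  next
    case 3
    \<comment> \<open>For m = 2 the two alternatives are D = -1/2 and D = 0.\<close>
    then have D: "D = -1/2" using D2 \<open>D \<noteq> 0\<close> by (auto simp: M_def field_simps)
    have "cf h 1 1 = 0" "cf h 0 2 = - a"
      using a1 a2 3 by (simp_all add: bw_2 bw_3 D)
    then have "h = homp [a, 0, -a]"
      using hom 3 by (intro homp_eqI) (auto simp: a_def less_Suc_eq numeral_2_eq_2)
    then show ?thesis using 3 a \<Delta> D by (auto simp: M_def)
  qed
qed

section \<open>Reduction to homogeneous cocycles for the generator L\<close>

definition cob :: "complex \<Rightarrow> complex \<Rightarrow> complex poly \<Rightarrow> bipoly" where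
  "cob \<Delta> D p = [:[:0, 1:], [:\<Delta>:]:] * [:p:] - [:[:0, 1:], [:D:]:] * addvar p"

lemma bev_cob [simp]: "bev (cob \<Delta> D p) x z = L_coboundary 0 0 \<Delta> D p x z"
  by (simp add: cob_def L_coboundary_def algebra_simps)

lemma L_cocycle_cob: "L_cocycle 0 0 \<Delta> D (cob \<Delta> D p)"
  by (simp add: L_cocycle_def L_coboundary_def add_ac) (simp add: algebra_simps)

lemma L_cocycle_diff:
  assumes "L_cocycle \<alpha> \<alpha>b \<Delta> D f" "L_cocycle \<alpha> \<alpha>b \<Delta> D g"
  shows "L_cocycle \<alpha> \<alpha>b \<Delta> D (f - g)"
  unfolding L_cocycle_def
proof (intro allI, goal_cases)
  case (1 x z w)
  show ?case
    using assms [unfolded L_cocycle_def, rule_format, of x z w] unfolding bev_diff by algebra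
qed

lemma L_cocycle_smult:
  assumes "L_cocycle \<alpha> \<alpha>b \<Delta> D f"
  shows "L_cocycle \<alpha> \<alpha>b \<Delta> D (smult [:c:] f)"
  unfolding L_cocycle_def
proof (intro allI, goal_cases)
  case (1 x z w)
  have c: "bev (smult [:c:] f) u v = c * bev f u v" for u v by simp
  show ?case
    using assms [unfolded L_cocycle_def, rule_format, of x z w] unfolding c by algebra
qed

lemma cf_cob_0: "cf (cob \<Delta> D p) i 0 = 0"
  by (cases i) (simp_all add: cob_def coeff_addvar coeff_linear_mult)

lemma cf_cob:
  assumes "l \<ge> 1"
  shows "cf (cob \<Delta> D p) i l = (if l = 1 then \<Delta> * coeff p i else 0) - coeff p (i + l - 1) * bw D (i + l - 1) l"
  using assms by (cases l; cases i)
    (auto simp: cob_def coeff_addvar coeff_linear_mult bw_def binomial_eq_0 coeff_pCons algebra_simps split: nat.splits)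

text \<open>At x = 0 and w = 0 the identity reads D z f(z, 0) = \<Delta> z f(0, 0). So, for nonzero
  \<open>D\<close>, the part of \<open>f\<close> free of \<lambda> is constant, and it is zero
  unless \<Delta> = D.\<close>

lemma L_cocycle_coeff_0:
  assumes "L_cocycle 0 0 \<Delta> D f"
  shows "D * cf f i 0 = (if i = 0 then \<Delta> * cf f 0 0 else 0)"
proof -
  have "[:0, D:] * coeff f 0 = [:0, \<Delta> * cf f 0 0:]"
  proof (rule poly_ext)
    fix z
    have "bev f x 0 = poly (coeff f 0) x" for x
      by (cases f) simp
    then show "poly ([:0, D:] * coeff f 0) z = poly [:0, \<Delta> * cf f 0 0:] z"
      using assms [unfolded L_cocycle_def, rule_format, of 0 z 0]
      by (simp add: algebra_simps poly_0_coeff_0)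
  qed
  from arg_cong [OF this, of "\<lambda>q. coeff q (Suc i)"] show ?thesis
    by (cases i) (simp_all add: coeff_linear_mult)
qed

text \<open>The Euler equation (k = 1) multiplies a coefficient of degree i + l by \<Delta> - D - (i
  + l - 1) and gives the same multiple of a coefficient of a coboundary. Hence \<open>f\<close>
  agrees with a coboundary in every degree where this factor is nonzero, apart from a possible
  constant.\<close>

lemma L_cocycle_reduce:
  assumes coc: "L_cocycle 0 0 \<Delta> D f" and D: "D \<noteq> 0"
  obtains q where
    "\<And>i l. cf (f - cob \<Delta> D q) i l \<noteq> 0 \<Longrightarrow> (l \<ge> 1 \<and> of_nat (i + l - 1) = \<Delta> - D) \<or> (i = 0 \<and> l = 0 \<and> \<Delta> = D)"
proof -
  \<comment> \<open>Division by the Euler factor on the \<lambda>-linear part of \<open>f\<close>;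
    the value is 0 in the resonant degree, where the factor vanishes.\<close>
  define c where "c n = (if of_nat n = \<Delta> - D then 0 else cf f n 1 / (\<Delta> - D - of_nat n))" for n
  define q where "q = (\<Sum>n\<le>degree (coeff f 1). monom (c n) n)"
  have q: "coeff q n = c n" for n
    by (simp add: q_def coeff_sum c_def coeff_eq_0)
  show thesis
  proof (rule that [of q], rule ccontr)
    fix i l
    assume *: "cf (f - cob \<Delta> D q) i l \<noteq> 0"
      "\<not> ((l \<ge> 1 \<and> of_nat (i + l - 1) = \<Delta> - D) \<or> (i = 0 \<and> l = 0 \<and> \<Delta> = D))"
    show False
    proof (cases "l = 0")
      case True
      then show False
        using * L_cocycle_coeff_0 [OF coc, of i] D by (auto simp: cf_cob_0 split: if_splits)
    next
      case False
      then have l: "l \<ge> 1" by simp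
      then have ne: "of_nat (i + l - 1) \<noteq> \<Delta> - D" using * by blast
      then have ne': "\<Delta> - D - of_nat (i + l - 1) \<noteq> 0" by simp
      have il: "of_nat (i + l - 1) = of_nat i + of_nat l - (1 :: complex)"
        using l by (simp add: of_nat_diff)
      have "cf f (i + l - 1) 1 * bw D (i + l - 1) l + \<Delta> * cf f i l - cf f i l * bw D i 1
          - (if l = 1 then \<Delta> * cf f i 1 else 0) = cf f i l * (of_nat l - 1)"
        using L_cocycle_coeff [OF coc order_refl l, of i] l by simp
      then have "cf f i l * (\<Delta> - D - of_nat (i + l - 1)) =
          (if l = 1 then \<Delta> * cf f i 1 else 0) - cf f (i + l - 1) 1 * bw D (i + l - 1) l"
        unfolding il bw_1 by algebra
      moreover have c: "c (i + l - 1) * (\<Delta> - D - of_nat (i + l - 1)) = cf f (i + l - 1) 1"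
        unfolding c_def if_not_P [OF ne] using ne' by (rule nonzero_eq_divide_eq [THEN iffD1, OF _ refl])
      moreover have "(if l = 1 then \<Delta> * c i else 0) * (\<Delta> - D - of_nat (i + l - 1))
          = (if l = 1 then \<Delta> * cf f i 1 else 0)"
        using c by (cases "l = 1") simp_all
      ultimately have "cf f i l * (\<Delta> - D - of_nat (i + l - 1)) =
          ((if l = 1 then \<Delta> * c i else 0) - c (i + l - 1) * bw D (i + l - 1) l) * (\<Delta> - D - of_nat (i + l - 1))"
        by algebra
      then have "cf f i l = (if l = 1 then \<Delta> * c i else 0) - c (i + l - 1) * bw D (i + l - 1) l"
        using ne' by simp
      then show False
        using * l by (cases "l = 1") (simp_all add: cf_cob q)
    qed
  qed
qed

section \<open>Homogeneous cocycles divisible by \<open>\<lambda>^2\<close>\<close>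

definition homog :: "nat \<Rightarrow> bipoly \<Rightarrow> bool" where
  "homog N r \<longleftrightarrow> (\<forall>i l. cf r i l \<noteq> 0 \<longrightarrow> i + l = N \<and> 2 \<le> l)"

lemma homog_diff: "homog N r \<Longrightarrow> homog N s \<Longrightarrow> homog N (r - s)"
  unfolding homog_def by (metis coeff_diff diff_zero)

lemma homog_smult: "homog N r \<Longrightarrow> homog N (smult [:c:] r)"
  unfolding homog_def by auto

text \<open>The parameter \<Delta> takes the value for which degree \<open>N\<close> is resonant.
  There the coboundary of \<open>\<partial>^(N-1)\<close> loses its \<lambda>-linear term; up to
  scalars it is the only coboundary homogeneous of degree \<open>N\<close>.\<close>

definition top_cob :: "complex \<Rightarrow> nat \<Rightarrow> bipoly" where
  "top_cob D N = cob (D + of_nat N - 1) D (monom 1 (N - 1))"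

lemma homog_top_cob:
  assumes "N \<ge> 2"
  shows "homog N (top_cob D N)"
  unfolding homog_def
proof (intro allI impI)
  fix i l
  assume *: "cf (top_cob D N) i l \<noteq> 0"
  have "cf (cob (D + of_nat N - 1) D (monom 1 (N - 1))) (N - 1) 1 = 0"
    using assms by (subst cf_cob) (simp_all add: bw_1 of_nat_diff del: One_nat_def)
  with * show "i + l = N \<and> 2 \<le> l"
    using assms by (cases "l = 0"; cases "l = 1") (auto simp: top_cob_def cf_cob_0 cf_cob split: if_splits)
qed

lemma cf_top_cob:
  assumes "N \<ge> l" "l \<ge> 2"
  shows "cf (top_cob D N) (N - l) l = - bw D (N - 1) l"
  using assms by (simp add: top_cob_def cf_cob)

lemma homog_eq:
  assumes coc: "L_cocycle 0 0 \<Delta> D r" and "k \<ge> 2" "l \<ge> 2" "k + l \<le> N + 1"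
  shows "cf r (N - k) k * bw D (N - k) l - cf r (N - l) l * bw D (N - l) k
     = cf r (N + 1 - l - k) (l + k - 1) * (of_nat (l + k - 1 choose k) - of_nat (l + k - 1 choose l))"
proof -
  have "N + 1 - l - k + l - 1 = N - k" "N + 1 - l - k + k - 1 = N - l"
    using assms by simp_all
  then show ?thesis
    using L_cocycle_coeff [OF coc, of k l "N + 1 - l - k"] assms by simp
qed

text \<open>For k = 2 the equation is a recursion: the factor on the right is nonzero for l \<ge> 3,
  so the coefficients at \<open>\<lambda>^2\<close> and \<open>\<lambda>^l\<close> determine the one
  at \<open>\<lambda>^(l+1)\<close>.\<close>

lemma homog_eq_2:
  assumes "L_cocycle 0 0 \<Delta> D r" and "3 \<le> l" "l < N"
  shows "cf r (N - 2) 2 * bw D (N - 2) l - cf r (N - l) l * bw D (N - l) 2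
     = cf r (N - Suc l) (Suc l) * ((of_nat l + 1) * (of_nat l - 2) / 2)"
proof -
  have "of_nat (Suc l choose 2) - of_nat (Suc l choose l) = (of_nat l + 1) * (of_nat l - 2) / (2 :: complex)"
    by (simp add: of_nat_choose_2 field_simps del: binomial_Suc_Suc)
  then show ?thesis
    using homog_eq [OF assms(1), of 2 l N] assms by simp
qed

lemma homog_zero:
  assumes coc: "L_cocycle 0 0 \<Delta> D r" and hom: "homog N r"
    and "cf r (N - 2) 2 = 0" "cf r (N - 3) 3 = 0"
  shows "r = 0"
proof -
  have A: "cf r (N - l) l = 0" if "3 \<le> l" for l
    using that
  proof (induction l rule: dec_induct)
    case base
    show ?case using assms by simp
  next
    case (step l)
    show ?case
    proof (cases "Suc l \<le> N")
      case True
      have "of_nat l + 1 \<noteq> (0::complex)"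
        by (metis of_nat_Suc of_nat_neq_0 add.commute)
      moreover have "of_nat l \<noteq> (2::complex)"
        using step(1) by (metis of_nat_eq_iff of_nat_numeral Suc_n_not_le_n numeral_3_eq_3 numeral_2_eq_2)
      ultimately show ?thesis
        using homog_eq_2 [OF coc, of l N] True step assms by simp
    next
      case False
      \<comment> \<open>Here the subtraction from \<open>N\<close> is truncated to 0, and the total
        degree exceeds \<open>N\<close>.\<close>
      then show ?thesis using hom unfolding homog_def by (metis le_add2)
    qed
  qed
  show ?thesis
  proof (rule poly_eqI, rule poly_eqI, rule ccontr)
    fix l i
    assume *: "cf r i l \<noteq> cf 0 i l"
    then have "i + l = N" "2 \<le> l"
      using hom unfolding homog_def by simp_all
    then have "i = N - l"
      by simp
    then show False
      using * A [of l] assms \<open>2 \<le> l\<close> by (cases "l = 2") auto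
  qed
qed

text \<open>By \<open>homog_zero\<close> a homogeneous cocycle is determined by its coefficients at
  \<open>\<lambda>^2\<close> and \<open>\<lambda>^3\<close>. By \<open>det\<close> these two
  coefficients of \<open>e\<close> and of \<open>top_cob D N\<close> form linearly independent
  vectors, and Cramer's rule gives \<open>c\<close> and \<open>d\<close>.\<close>

lemma homog_span:
  assumes coc: "L_cocycle 0 0 \<Delta> D r" "L_cocycle 0 0 \<Delta> D e" and hom: "homog N r" "homog N e"
    and N: "N \<ge> 3" "\<Delta> = D + of_nat N - 1"
    and det: "cf e (N - 2) 2 * bw D (N - 1) 3 \<noteq> cf e (N - 3) 3 * bw D (N - 1) 2"
  shows "\<exists>c d. r = smult [:c:] e + smult [:d:] (top_cob D N)"
proof -
  define \<delta> where "\<delta> = cf e (N - 2) 2 * bw D (N - 1) 3 - cf e (N - 3) 3 * bw D (N - 1) 2"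
  define c where "c = (cf r (N - 2) 2 * bw D (N - 1) 3 - cf r (N - 3) 3 * bw D (N - 1) 2) / \<delta>"
  define d where "d = (cf r (N - 2) 2 * cf e (N - 3) 3 - cf r (N - 3) 3 * cf e (N - 2) 2) / \<delta>"
  have \<delta>: "\<delta> \<noteq> 0" using det by (simp add: \<delta>_def)
  have "r - smult [:c:] e - smult [:d:] (top_cob D N) = 0"
  proof (rule homog_zero)
    show "L_cocycle 0 0 \<Delta> D (r - smult [:c:] e - smult [:d:] (top_cob D N))"
      using coc N by (auto intro!: L_cocycle_diff L_cocycle_smult simp: top_cob_def L_cocycle_cob)
    show "homog N (r - smult [:c:] e - smult [:d:] (top_cob D N))"
      using hom N by (auto intro!: homog_diff homog_smult homog_top_cob)
    have "cf r (N - 2) 2 * \<delta> = \<delta> * c * cf e (N - 2) 2 - \<delta> * d * bw D (N - 1) 2"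
      using \<delta> by (simp add: c_def d_def) (simp add: \<delta>_def algebra_simps)
    then show "cf (r - smult [:c:] e - smult [:d:] (top_cob D N)) (N - 2) 2 = 0"
      using \<delta> N by (simp add: cf_top_cob) algebra
    have "cf r (N - 3) 3 * \<delta> = \<delta> * c * cf e (N - 3) 3 - \<delta> * d * bw D (N - 1) 3"
      using \<delta> by (simp add: c_def d_def) (simp add: \<delta>_def algebra_simps)
    then show "cf (r - smult [:c:] e - smult [:d:] (top_cob D N)) (N - 3) 3 = 0"
      using \<delta> N by (simp add: cf_top_cob) algebra
  qed
  then show ?thesis
    by (metis add.commute diff_eq_eq eq_iff_diff_eq_0)
qed

text \<open>In any coboundary the two coefficients in question come from the single coefficient of
  \<open>\<partial>^(N-1)\<close> in \<open>q\<close>, so they are proportional to those of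
  \<open>top_cob D N\<close>; \<open>det\<close> then excludes nonzero multiples of
  \<open>e\<close>.\<close>

lemma homog_nontrivial:
  assumes N: "N \<ge> 3" and det: "cf e (N - 2) 2 * bw D (N - 1) 3 \<noteq> cf e (N - 3) 3 * bw D (N - 1) 2"
    and triv: "smult [:c:] e = cob \<Delta> D q"
  shows "c = 0"
proof -
  have "Suc (N - 2) = N - 1" "Suc (Suc (N - 3)) = N - 1" "Suc (Suc (N - Suc (Suc (Suc 0)))) = N - 1"
    using N by simp_all
  note [simp] = this
  have "c * cf e (N - 2) 2 = - coeff q (N - 1) * bw D (N - 1) 2"
    using arg_cong [OF triv, of "\<lambda>f. cf f (N - 2) 2"] N by (simp add: cf_cob)
  moreover have "c * cf e (N - 3) 3 = - coeff q (N - 1) * bw D (N - 1) 3"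
    using arg_cong [OF triv, of "\<lambda>f. cf f (N - 3) 3"] N by (simp add: cf_cob)
  ultimately have "c * (cf e (N - 2) 2 * bw D (N - 1) 3 - cf e (N - 3) 3 * bw D (N - 1) 2) = 0"
    by algebra
  then show ?thesis using det by simp
qed

section \<open>Homogeneous cocycles of high degree\<close>

text \<open>The Virasoro part of the list for \<alpha> = 0. The two values involving sqrt 19 are
  encoded as the roots of a quadratic equation, which keeps all verifications polynomial.\<close>

definition vir_list :: "complex \<Rightarrow> complex \<Rightarrow> bipoly set" where
  "vir_list \<Delta> D = {e.
     (\<Delta> = D \<and> (\<exists>c0 c1. (c0, c1) \<noteq> (0, 0) \<and> e = [:[:c0:], [:c1:]:]))
   \<or> (\<Delta> - D = 2 \<and> e = homp [0, 0, 2, 1])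
   \<or> (\<Delta> - D = 3 \<and> e = homp [0, 0, 1, 1, 0])
   \<or> (\<Delta> - D = 4 \<and> e = homp [0, 0, 4, 6, -1, D])
   \<or> (\<Delta> - D = 5 \<and> D = -4 \<and> e = homp [0, 0, 1, 0, -10, -17, -8])
   \<or> (\<Delta> - D = 6 \<and> (2 * D + 5)\<^sup>2 = 19 \<and>
        e = homp [0, 0, 0, 1, - (2 * D + 3), - (3 * D), - (3 * D + 1), - (D + 9/28)])}"

lemma homog_homp: "homog N (homp xs)" if "length xs = N + 1" "N \<ge> 1" "xs ! 0 = 0" "xs ! 1 = 0"
  unfolding homog_def cf_homp
proof (intro allI impI)
  fix i l
  assume "(if i + l + 1 = length xs then xs ! l else 0) \<noteq> 0"
  with that show "i + l = N \<and> 2 \<le> l"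
    by (cases "l = 0"; cases "l = 1") (auto split: if_splits)
qed

lemma homp_L_cocycle:
  "L_cocycle 0 0 (D + 2) D (homp [0, 0, 2, 1])"
  "L_cocycle 0 0 (D + 3) D (homp [0, 0, 1, 1, 0])"
  "L_cocycle 0 0 (D + 4) D (homp [0, 0, 4, 6, -1, D])"
  "L_cocycle 0 0 1 (-4) (homp [0, 0, 1, 0, -10, -17, -8])"
  unfolding L_cocycle_def
  by (intro allI; simp add: bev_homp lessThan_Suc; algebra)+

text \<open>The defect in the cocycle identity is quadratic in \<open>D\<close> and is divisible by
  (2D + 5)^2 - 19. The factor 28 clears the denominator.\<close>

lemma homp_L_cocycle_6:
  assumes "(2 * D + 5)\<^sup>2 = 19"
  shows "L_cocycle 0 0 (D + 6) D (homp [0, 0, 0, 1, - (2 * D + 3), - (3 * D), - (3 * D + 1), - (D + 9/28)])"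
    (is "L_cocycle _ _ _ _ ?e")
  unfolding L_cocycle_def
proof (intro allI, goal_cases)
  case (1 x z w)
  have bev: "28 * bev ?e x z = 28 * x ^ 4 * z ^ 3 - 28 * (2 * D + 3) * x ^ 3 * z ^ 4 - 28 * 3 * D * x ^ 2 * z ^ 5
      - 28 * (3 * D + 1) * x * z ^ 6 - (28 * D + 9) * z ^ 7" for x z
    by (simp add: bev_homp lessThan_Suc eval_nat_numeral algebra_simps)
  \<comment> \<open>\<open>G\<close> is the coefficient of \<open>D\<close> in \<open>?e\<close>.
    The part of the defect in D^2 is built from it, and that part determines the quotient.\<close>
  define G where "G x z = - 2 * x ^ 3 * z ^ 4 - 3 * x ^ 2 * z ^ 5 - 3 * x * z ^ 6 - z ^ 7" for x z :: complex
  have "28 * ((x + 0 + D * z) * bev ?e (x + z) w + (x + z + 0 + (D + 6) * w) * bev ?e x z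
      - (x + 0 + D * w) * bev ?e (x + w) z - (x + w + 0 + (D + 6) * z) * bev ?e x w - (z - w) * bev ?e x (z + w))
    = (x + D * z) * (28 * bev ?e (x + z) w) + (x + z + (D + 6) * w) * (28 * bev ?e x z)
      - (x + D * w) * (28 * bev ?e (x + w) z) - (x + w + (D + 6) * z) * (28 * bev ?e x w)
      - (z - w) * (28 * bev ?e x (z + w))"
    by (simp add: right_diff_distrib distrib_left mult_ac)
  also have "\<dots> = 7 * ((2 * D + 5)\<^sup>2 - 19) * (z * G (x + z) w + w * G x z - w * G (x + w) z - z * G x w)"
    unfolding bev G_def by algebra
  also have "\<dots> = 0"
    using assms by simp
  finally show ?case
    by (metis mult_eq_0_iff right_minus_eq zero_neq_numeral)
qed

lemma choose_values:
  "(6::nat) choose 3 = 20" "(6::nat) choose 4 = 15" "(8::nat) choose 4 = 70" "(8::nat) choose 5 = 56"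
  by (simp_all add: eval_nat_numeral)

lemma bw_cleared:
  fixes n :: nat
  defines "\<nu> \<equiv> of_nat n :: complex"
  shows bw_2': "2 * bw D n 2 = \<nu> * (\<nu> - 1 + 2 * D)"
    and bw_3': "6 * bw D n 3 = \<nu> * (\<nu> - 1) * (\<nu> - 2 + 3 * D)"
    and bw_4': "24 * bw D n 4 = \<nu> * (\<nu> - 1) * (\<nu> - 2) * (\<nu> - 3 + 4 * D)"
    and bw_5': "120 * bw D n 5 = \<nu> * (\<nu> - 1) * (\<nu> - 2) * (\<nu> - 3) * (\<nu> - 4 + 5 * D)"
  by (simp_all add: bw_def of_nat_choose flip: \<nu>_def) (simp_all add: field_simps)

text \<open>The recursion expresses all coefficients through the one at \<open>\<lambda>^3\<close>.
  The equation for exponents 3 and 4, available from N = 6 on, yields the quadratic condition; the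
  one for 4 and 5, available from N = 8 on, is incompatible with it.\<close>

lemma homog_exceptional:
  assumes coc: "L_cocycle 0 0 \<Delta> D r" and N: "N \<ge> 6" and r2: "cf r (N - 2) 2 = 0" and r3: "cf r (N - 3) 3 \<noteq> 0"
    and T: "2 * D + of_nat N - 2 \<noteq> 0"
  shows "N < 8" "(2 * D + of_nat N - 2)\<^sup>2 = 3 * of_nat N - 2"
proof -
  define \<nu> T where "\<nu> = (of_nat N :: complex)" and "T = 2 * D + \<nu> - 2"
  have T0: "T \<noteq> 0" using T by (simp add: T_def \<nu>_def)
  have D: "2 * D = T - \<nu> + 2" by (simp add: T_def)
  have ne: "\<nu> - of_nat k \<noteq> 0" if "k < N" for k
    using that by (simp add: \<nu>_def)
  have ofk: "of_nat (N - k) = \<nu> - of_nat k" if "k \<le> N" for k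
    using that by (simp add: \<nu>_def of_nat_diff)
  define A where "A l = cf r (N - l) l" for l
  have A: "A 2 = 0" "A 3 \<noteq> 0" using r2 r3 by (simp_all add: A_def)
  \<comment> \<open>As \<open>A 2\<close> = 0 the recursion has only two terms, and \<open>D\<close>
    enters through \<open>T\<close> alone.\<close>
  have eq2: "A (Suc l) * ((of_nat l + 1) * (of_nat l - 2)) = - A l * ((\<nu> - of_nat l) * (T + 1 - of_nat l))"
    if "3 \<le> l" "l < N" for l
  proof -
    have "2 * bw D (N - l) 2 = (\<nu> - of_nat l) * (T + 1 - of_nat l)"
      unfolding bw_2' ofk [OF less_imp_le [OF that(2)]] T_def by algebra
    moreover have "- A l * bw D (N - l) 2 = A (Suc l) * ((of_nat l + 1) * (of_nat l - 2) / 2)"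
      using homog_eq_2 [OF coc that] A by (simp add: A_def)
    ultimately show ?thesis
      by (simp add: field_simps) algebra
  qed
  have A4: "A 4 * 4 = - A 3 * ((\<nu> - 3) * (T - 2))"
    and A5: "A 5 * 10 = - A 4 * ((\<nu> - 4) * (T - 3))"
    and A6: "A 6 * 18 = - A 5 * ((\<nu> - 5) * (T - 4))"
    using eq2 [of 3] eq2 [of 4] eq2 [of 5] N by simp_all
  have "A 3 * bw D (N - 3) 4 - A 4 * bw D (N - 4) 3 = A 6 * 5"
    using homog_eq [OF coc, of 3 4 N] N by (simp add: A_def choose_values)
  moreover
  have "24 * bw D (N - 3) 4 = (\<nu> - 3) * (\<nu> - 4) * (\<nu> - 5) * (\<nu> - 6 + 2 * (T - \<nu> + 2))"
    and "12 * bw D (N - 4) 3 = (\<nu> - 4) * (\<nu> - 5) * (2 * (\<nu> - 6) + 3 * (T - \<nu> + 2))"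
    using bw_4' [of D "N - 3"] bw_3' [of D "N - 4"] ofk [of 3] ofk [of 4] N D by simp_all algebra+
  then have "144 * (A 3 * bw D (N - 3) 4 - A 4 * bw D (N - 4) 3 - A 6 * 5)
      = A 3 * (\<nu> - 3) * (\<nu> - 4) * (\<nu> - 5) * T * (T\<^sup>2 - (3 * \<nu> - 2))"
    using A4 A5 A6 by algebra
  ultimately have "A 3 * (\<nu> - 3) * (\<nu> - 4) * (\<nu> - 5) * T * (T\<^sup>2 - (3 * \<nu> - 2)) = 0"
    by simp
  then have T2: "T\<^sup>2 = 3 * \<nu> - 2"
    using N A T0 ne [of 3] ne [of 4] ne [of 5] by auto
  then show "(2 * D + of_nat N - 2)\<^sup>2 = 3 * of_nat N - 2"
    by (simp add: T_def \<nu>_def)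
  show "N < 8"
  proof (rule ccontr)
    assume "\<not> N < 8"
    then have N: "N \<ge> 8" by simp
    have A7: "A 7 * 28 = - A 6 * ((\<nu> - 6) * (T - 5))"
      and A8: "A 8 * 40 = - A 7 * ((\<nu> - 7) * (T - 6))"
      using eq2 [of 6] eq2 [of 7] N by simp_all
    have e45: "A 4 * bw D (N - 4) 5 - A 5 * bw D (N - 5) 4 = A 8 * 14"
      using homog_eq [OF coc, of 4 5 N] N by (simp add: A_def choose_values)
    have "240 * bw D (N - 4) 5 = (\<nu> - 4) * (\<nu> - 5) * (\<nu> - 6) * (\<nu> - 7) * (2 * (\<nu> - 8) + 5 * (T - \<nu> + 2))"
      and "24 * bw D (N - 5) 4 = (\<nu> - 5) * (\<nu> - 6) * (\<nu> - 7) * (\<nu> - 8 + 2 * (T - \<nu> + 2))"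
      using bw_5' [of D "N - 4"] bw_4' [of D "N - 5"] ofk [of 4] ofk [of 5] N D by simp_all algebra+
    note b = this
    have A5': "A 5 * 40 = A 3 * ((\<nu> - 3) * (T - 2)) * ((\<nu> - 4) * (T - 3))"
      using A4 A5 by algebra
    have "A 6 * 720 = - (A 5 * 40) * ((\<nu> - 5) * (T - 4))"
      using A6 by algebra
    then have "A 7 * 20160 = (A 5 * 40) * ((\<nu> - 5) * (T - 4)) * ((\<nu> - 6) * (T - 5))"
      using A7 by algebra
    then have A8': "A 8 * 806400 = - (A 5 * 40) * ((\<nu> - 5) * (T - 4)) * ((\<nu> - 6) * (T - 5)) * ((\<nu> - 7) * (T - 6))"
      using A8 by algebra
    have "57600 * (A 4 * bw D (N - 4) 5 - A 5 * bw D (N - 5) 4 - A 8 * 14)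
       = 60 * (A 4 * 4) * (240 * bw D (N - 4) 5) - 60 * (A 5 * 40) * (24 * bw D (N - 5) 4) - A 8 * 806400"
      by simp
    also have "\<dots> = A 3 * (\<nu> - 3) * (\<nu> - 4) * (\<nu> - 5) * (\<nu> - 6) * (\<nu> - 7)
         * (T * (T^4 - 20 * T^3 + 35 * T^2 + 20 * (3 * \<nu> - 2) * T - (120 * \<nu> - 84)))"
      unfolding b A8' A5' A4 by algebra
    finally have "A 3 * (\<nu> - 3) * (\<nu> - 4) * (\<nu> - 5) * (\<nu> - 6) * (\<nu> - 7)
         * (T * (T^4 - 20 * T^3 + 35 * T^2 + 20 * (3 * \<nu> - 2) * T - (120 * \<nu> - 84))) = 0"
      using e45 by simp
    then have "T * (T^4 - 20 * T^3 + 35 * T^2 + 20 * (3 * \<nu> - 2) * T - (120 * \<nu> - 84)) = 0"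
      using N A ne [of 3] ne [of 4] ne [of 5] ne [of 6] ne [of 7] by auto
    \<comment> \<open>Inserting 3 \<nu> = T^2 + 2 turns the second factor into (T^2 - 1) (T^2 - 4) =
      9 (\<nu> - 1) (\<nu> - 2).\<close>
    then have "T * (\<nu> - 1) * (\<nu> - 2) = 0"
      using T2 by algebra
    then show False
      using T0 N ne [of 1] ne [of 2] by auto
  qed
qed

text \<open>The excluded value \<open>T = 0\<close> is the fixed point of the duality \<open>(\<Delta>, D) \<mapsto> (1 - D, 1 - \<Delta>)\<close>. There the coboundary
  of \<open>\<partial>\<^sup>N\<^sup>-\<^sup>1\<close> has no \<open>\<lambda>\<^sup>2\<close> term, so it is used to remove the coefficient at \<open>\<lambda>\<^sup>3\<close> instead.\<close>

lemma homog_self_dual: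
  assumes coc: "L_cocycle 0 0 \<Delta> D r" and N: "N \<ge> 6" and r3: "cf r (N - 3) 3 = 0"
    and T: "2 * D + of_nat N - 2 = 0"
  shows "cf r (N - 2) 2 = 0"
proof -
  define \<nu> where "\<nu> = (of_nat N :: complex)"
  have D: "2 * D = 2 - \<nu>" using T unfolding \<nu>_def by algebra
  have ne: "\<nu> - of_nat k \<noteq> 0" if "k < N" for k
    using that by (simp add: \<nu>_def)
  have ofk: "of_nat (N - k) = \<nu> - of_nat k" if "k \<le> N" for k
    using that by (simp add: \<nu>_def of_nat_diff)
  define A where "A l = cf r (N - l) l" for l
  have A: "A 3 = 0" using r3 by (simp_all add: A_def)
  have b: "12 * bw D (N - 2) 3 = (\<nu> - 2) * (\<nu> - 3) * (2 * (\<nu> - 4) + 3 * (2 - \<nu>))"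
    "24 * bw D (N - 2) 4 = (\<nu> - 2) * (\<nu> - 3) * (\<nu> - 4) * (\<nu> - 5 + 2 * (2 - \<nu>))"
    "240 * bw D (N - 2) 5 = (\<nu> - 2) * (\<nu> - 3) * (\<nu> - 4) * (\<nu> - 5) * (2 * (\<nu> - 6) + 5 * (2 - \<nu>))"
    "2 * bw D (N - 4) 2 = (\<nu> - 4) * (- 3)"
    "2 * bw D (N - 5) 2 = (\<nu> - 5) * (- 4)"
    "12 * bw D (N - 4) 3 = (\<nu> - 4) * (\<nu> - 5) * (2 * (\<nu> - 6) + 3 * (2 - \<nu>))"
    using bw_cleared [of D "N - 2"] bw_cleared [of D "N - 4"] bw_cleared [of D "N - 5"]
      ofk [of 2] ofk [of 4] ofk [of 5] N D
    by simp_all algebra+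
  have "A 2 * bw D (N - 2) 3 = A 4 * 2"
    "A 2 * bw D (N - 2) 4 - A 4 * bw D (N - 4) 2 = A 5 * 5"
    "A 2 * bw D (N - 2) 5 - A 5 * bw D (N - 5) 2 = A 6 * 9"
    using homog_eq_2 [OF coc, of 3 N] homog_eq_2 [OF coc, of 4 N] homog_eq_2 [OF coc, of 5 N] N A
    by (simp_all add: A_def)
  moreover have "- A 4 * bw D (N - 4) 3 = A 6 * 5"
    using homog_eq [OF coc, of 3 4 N] N A by (simp add: A_def choose_values)
  \<comment> \<open>Eliminating \<open>A 4\<close>, \<open>A 5\<close> and \<open>A 6\<close> from
    the four equations leaves a multiple of \<open>A 2\<close>.\<close>
  ultimately have "A 2 * ((\<nu> - 2) * (\<nu> - 3) * (\<nu> - 4) * (\<nu> - 5) * \<nu> * (3 * \<nu> - 2)) = 0"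
    using b by algebra
  moreover have "3 * \<nu> - 2 \<noteq> 0"
  proof -
    have "3 * \<nu> - 2 = of_nat (3 * N - 2)"
      using N by (simp add: \<nu>_def of_nat_diff)
    moreover have "3 * N - 2 \<noteq> 0"
      using N by simp
    ultimately show ?thesis
      by (simp only: of_nat_eq_0_iff not_False_eq_True)
  qed
  ultimately show ?thesis
    using N ne [of 2] ne [of 3] ne [of 4] ne [of 5] ne [of 0] by (auto simp: A_def)
qed

section \<open>Classification of the cocycles for L\<close>

lemma L_cocycle_top_cob: "\<Delta> = D + of_nat N - 1 \<Longrightarrow> L_cocycle 0 0 \<Delta> D (top_cob D N)"
  by (simp add: top_cob_def L_cocycle_cob)

text \<open>Supplies, for each entry with \<Delta> different from \<open>D\<close>, the degree and
  the independence from \<open>top_cob\<close> on which \<open>homog_span\<close> and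
  \<open>homog_nontrivial\<close> rest.\<close>

lemma vir_list_homog:
  assumes e: "e \<in> vir_list \<Delta> D" and ne: "\<Delta> \<noteq> D" and D0: "D \<noteq> 0"
  obtains N where "N \<ge> 3" "\<Delta> = D + of_nat N - 1" "homog N e" "L_cocycle 0 0 \<Delta> D e"
    "cf e (N - 2) 2 * bw D (N - 1) 3 \<noteq> cf e (N - 3) 3 * bw D (N - 1) 2"
proof -
  consider "\<Delta> = D + 2" "e = homp [0, 0, 2, 1]"
    | "\<Delta> = D + 3" "e = homp [0, 0, 1, 1, 0]"
    | "\<Delta> = D + 4" "e = homp [0, 0, 4, 6, -1, D]"
    | "\<Delta> = 1" "D = -4" "e = homp [0, 0, 1, 0, -10, -17, -8]"
    | "\<Delta> = D + 6" "(2 * D + 5)\<^sup>2 = 19"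
       "e = homp [0, 0, 0, 1, - (2 * D + 3), - (3 * D), - (3 * D + 1), - (D + 9/28)]"
    using e ne unfolding vir_list_def by (auto simp: diff_eq_eq add.commute)
  then show thesis
  proof cases
    case 1
    show ?thesis
      by (rule that [of 3]) (use 1 D0 in \<open>auto intro!: homog_homp homp_L_cocycle simp: cf_homp bw_simps\<close>)
  next
    case 2
    show ?thesis
      by (rule that [of 4]) (use 2 D0 in \<open>auto intro!: homog_homp homp_L_cocycle simp: cf_homp bw_simps field_simps\<close>)
  next
    case 3
    show ?thesis
      by (rule that [of 5]) (use 3 D0 in \<open>auto intro!: homog_homp homp_L_cocycle simp: cf_homp bw_simps field_simps\<close>)
  next
    case 4
    show ?thesis
      by (rule that [of 6]) (use 4 D0 homp_L_cocycle(4) in \<open>auto intro!: homog_homp simp: cf_homp bw_simps\<close>)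
  next
    case 5
    \<comment> \<open>This is \<open>bw D 6 2\<close>, the determinant up to sign: the entry has
      coefficient 0 at \<open>\<lambda>^2\<close> and 1 at \<open>\<lambda>^3\<close>.\<close>
    have "15 + 6 * D \<noteq> 0"
    proof
      assume "15 + 6 * D = 0"
      then have "2 * D + 5 = 0" by algebra
      with 5(2) show False by simp
    qed
    moreover have "L_cocycle 0 0 \<Delta> D e"
      unfolding 5(1,3) by (rule homp_L_cocycle_6 [OF 5(2)])
    ultimately show ?thesis
      by (intro that [of 7]) (use 5 in \<open>auto intro!: homog_homp simp: cf_homp bw_simps\<close>)
  qed
qed

text \<open>For \<Delta> = D a coboundary has neither a constant term nor a term in \<lambda> alone,
  since the latter has coefficient (\<Delta> - D) q(0). The other entries fall under
  \<open>homog_nontrivial\<close>.\<close>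

lemma vir_list_nontrivial:
  assumes e: "e \<in> vir_list \<Delta> D" and D0: "D \<noteq> 0"
  shows "L_cocycle 0 0 \<Delta> D e" and "smult [:c:] e = cob \<Delta> D q \<Longrightarrow> c = 0"
proof -
  consider c0 c1 where "\<Delta> = D" "(c0, c1) \<noteq> (0, 0)" "e = [:[:c0:], [:c1:]:]" | "\<Delta> \<noteq> D"
    using e unfolding vir_list_def by (cases "\<Delta> = D") auto
  then have "L_cocycle 0 0 \<Delta> D e \<and> (smult [:c:] e = cob \<Delta> D q \<longrightarrow> c = 0)"
  proof cases
    case 1
    have "L_cocycle 0 0 \<Delta> D e"
      using 1 by (simp add: L_cocycle_def algebra_simps)
    moreover have "c = 0" if triv: "smult [:c:] e = cob \<Delta> D q"
    proof -
      have "c * c0 = 0"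
        using arg_cong [OF triv, of "\<lambda>f. cf f 0 0"] 1 by (auto simp: cf_cob_0)
      moreover have "c * c1 = 0"
        using arg_cong [OF triv, of "\<lambda>f. cf f 0 1"] 1 by (auto simp: cf_cob bw_def)
      ultimately show ?thesis using 1 by auto
    qed
    ultimately show ?thesis by blast
  next
    case 2
    then obtain N where "N \<ge> 3" "L_cocycle 0 0 \<Delta> D e"
      "cf e (N - 2) 2 * bw D (N - 1) 3 \<noteq> cf e (N - 3) 3 * bw D (N - 1) 2"
      using vir_list_homog [OF e 2 D0] by metis
    then show ?thesis
      using homog_nontrivial by blast
  qed
  then show "L_cocycle 0 0 \<Delta> D e" and "smult [:c:] e = cob \<Delta> D q \<Longrightarrow> c = 0"
    by blast+
qed

lemma smult_cob: "smult [:c:] (cob \<Delta> D q) = cob \<Delta> D (smult c q)"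
  by (rule bipoly_eqI) (simp add: L_coboundary_def algebra_simps)

lemma cob_add: "cob \<Delta> D p + cob \<Delta> D q = cob \<Delta> D (p + q)"
  by (rule bipoly_eqI) (simp add: L_coboundary_def algebra_simps)

lemma smult_top_cob:
  assumes "\<Delta> = D + of_nat N - 1"
  shows "\<exists>q. smult [:c:] (top_cob D N) = cob \<Delta> D q"
  using assms smult_cob by (auto simp: top_cob_def)

text \<open>If the list has an entry \<open>e\<close> for these parameters, its degree is
  \<open>N\<close>, and \<open>r\<close> lies in the span of \<open>e\<close> and
  \<open>top_cob D N\<close>. If it has none, the small degrees and the exceptional values of
  \<open>D\<close> are excluded, and \<open>r\<close> is a multiple of
  \<open>top_cob D N\<close>.\<close>

lemma homog_classification:
  assumes coc: "L_cocycle 0 0 \<Delta> D r" and hom: "homog N r" and D0: "D \<noteq> 0"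
    and N: "N \<ge> 2" and \<Delta>: "\<Delta> = D + of_nat N - 1"
  shows "\<exists>q c e. r = cob \<Delta> D q + smult [:c:] e \<and> (c = 0 \<or> e \<in> vir_list \<Delta> D)"
proof (cases "\<exists>e. e \<in> vir_list \<Delta> D")
  case True
  then obtain e where e: "e \<in> vir_list \<Delta> D" by blast
  have ne: "\<Delta> \<noteq> D"
  proof
    assume "\<Delta> = D"
    with \<Delta> have "of_nat N = (of_nat 1 :: complex)" by simp
    with N show False unfolding of_nat_eq_iff by simp
  qed
  obtain M where M: "M \<ge> 3" "\<Delta> = D + of_nat M - 1" "homog M e" "L_cocycle 0 0 \<Delta> D e"
    "cf e (M - 2) 2 * bw D (M - 1) 3 \<noteq> cf e (M - 3) 3 * bw D (M - 1) 2"
    using vir_list_homog [OF e ne D0] .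
  have "M = N"
    using M(2) \<Delta> by (metis add_diff_cancel_left' diff_add_cancel of_nat_eq_iff)
  then obtain c d where "r = smult [:c:] e + smult [:d:] (top_cob D N)"
    using homog_span [OF coc M(4) hom] M by blast
  then show ?thesis
    using e smult_top_cob [OF \<Delta>, of d] by (metis add.commute)
next
  case False
  define T where "T = 2 * D + of_nat N - 2"
  have N': "N \<noteq> 3" "N \<noteq> 4" "N \<noteq> 5" "\<not> (N = 6 \<and> D = -4)" "\<not> (N = 7 \<and> (2 * D + 5)\<^sup>2 = 19)"
    using False \<Delta> unfolding vir_list_def by auto
  have bw2: "2 * bw D (N - 1) 2 = (of_nat N - 1) * T" and N1: "of_nat N - 1 \<noteq> (0 :: complex)"
    using bw_2' [of D "N - 1"] N by (simp_all add: T_def of_nat_diff algebra_simps)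
  define r' where "r' d = r - smult [:d:] (top_cob D N)" for d
  have r': "L_cocycle 0 0 \<Delta> D (r' d)" "homog N (r' d)" for d
    using coc hom N \<Delta> by (auto intro!: L_cocycle_diff L_cocycle_smult homog_diff homog_smult homog_top_cob L_cocycle_top_cob
        simp: r'_def)
  have r'_3: "cf (r' d) (N - 3) 3 = 0" if "N < 3" for d
    using r'(2) [of d] that unfolding homog_def by (metis add_leD2 leD order_refl)
  have "\<exists>d. cf (r' d) (N - 2) 2 = 0 \<and> cf (r' d) (N - 3) 3 = 0"
  proof (cases "T = 0")
    case True
    \<comment> \<open>For N = 2, T = 2D is nonzero; the degrees 3, 4, 5 are excluded by
      \<open>N'\<close>.\<close>
    then have "N \<ge> 6"
      using N N' D0 by (cases "N = 2") (auto simp: T_def)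
    have "6 * bw D (N - 1) 3 = (of_nat N - 1) * (of_nat N - 2) * (of_nat N - 3 + 3 * D)"
      using bw_3' [of D "N - 1"] N by (simp add: of_nat_diff)
    then have "12 * bw D (N - 1) 3 = - (of_nat N - 1) * (of_nat N - 2) * of_nat N"
      using True unfolding T_def by algebra
    moreover have "of_nat N \<noteq> (2 :: complex)"
      using of_nat_eq_iff [of N 2, where 'a = complex] \<open>N \<ge> 6\<close> by simp
    ultimately have ne: "bw D (N - 1) 3 \<noteq> 0"
      using N1 N by auto
    define d where "d = - cf r (N - 3) 3 / bw D (N - 1) 3"
    have "cf (r' d) (N - 3) 3 = 0"
      using ne \<open>N \<ge> 6\<close> by (simp add: r'_def d_def cf_top_cob)
    then show ?thesis
      using homog_self_dual [OF r'(1) \<open>N \<ge> 6\<close>] True unfolding T_def by blast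
  next
    case False
    then have ne: "bw D (N - 1) 2 \<noteq> 0"
      using bw2 N1 by auto
    define d where "d = - cf r (N - 2) 2 / bw D (N - 1) 2"
    have 2: "cf (r' d) (N - 2) 2 = 0"
      using ne N by (simp add: r'_def d_def cf_top_cob)
    have "cf (r' d) (N - 3) 3 = 0"
    proof (rule ccontr)
      assume 3: "cf (r' d) (N - 3) 3 \<noteq> 0"
      then have "N \<ge> 6" using r'_3 [of d] N N' by linarith
      then have *: "N < 8" "T\<^sup>2 = 3 * of_nat N - 2"
        using homog_exceptional [OF r'(1) _ 2 3] False by (auto simp: T_def)
      \<comment> \<open>The quadratic condition is (2D + 4)^2 = 16 for N = 6, so D = 0 or D = -4,
        and (2D + 5)^2 = 19 for N = 7; all these values are excluded.\<close>
      then consider "N = 6" | "N = 7" using \<open>N \<ge> 6\<close> by linarith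
      then show False
      proof cases
        case 1
        then have "(4 + 2 * D) * (4 + 2 * D) = 16"
          using * by (simp add: T_def power2_eq_square)
        moreover have "4 * (D * (D + 4)) = (4 + 2 * D) * (4 + 2 * D) - 16"
          by algebra
        ultimately have "D * (D + 4) = 0"
          by simp
        then show False using N' D0 1 by (auto simp: add_eq_0_iff2)
      next
        case 2
        then show False using * N' by (simp add: T_def add.commute)
      qed
    qed
    with 2 show ?thesis by blast
  qed
  then obtain d where "r' d = 0"
    using homog_zero r' by blast
  then have "r = smult [:d:] (top_cob D N)"
    by (simp add: r'_def)
  then show ?thesis
    using smult_top_cob [OF \<Delta>, of d] by (metis add.right_neutral smult_0_left pCons_0_0)
qed


text \<open>After \<open>L_cocycle_reduce\<close> only c0 + c1 \<lambda> remains if \<Delta> = D.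
  Otherwise a single degree remains, and the remainder is divisible by
  \<open>\<lambda>^2\<close>.\<close>

lemma L_cocycle_classification:
  assumes coc: "L_cocycle 0 0 \<Delta> D f" and D0: "D \<noteq> 0"
  shows "\<exists>q c e. f = cob \<Delta> D q + smult [:c:] e \<and> (c = 0 \<or> e \<in> vir_list \<Delta> D)"
proof -
  obtain q where q: "\<And>i l. cf (f - cob \<Delta> D q) i l \<noteq> 0 \<Longrightarrow>
      (l \<ge> 1 \<and> of_nat (i + l - 1) = \<Delta> - D) \<or> (i = 0 \<and> l = 0 \<and> \<Delta> = D)"
    using L_cocycle_reduce [OF coc D0] by blast
  define r where "r = f - cob \<Delta> D q"
  have r: "L_cocycle 0 0 \<Delta> D r"
    using coc L_cocycle_cob L_cocycle_diff unfolding r_def by blast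
  have "\<exists>q c e. r = cob \<Delta> D q + smult [:c:] e \<and> (c = 0 \<or> e \<in> vir_list \<Delta> D)"
  proof (cases "\<Delta> = D")
    case True
    define c0 c1 where "c0 = cf r 0 0" and "c1 = cf r 0 1"
    have "r = [:[:c0:], [:c1:]:]"
    proof (intro poly_eqI)
      fix l i
      have "cf r i l \<noteq> 0 \<Longrightarrow> i = 0 \<and> l \<le> 1"
        using q [of l i] True unfolding r_def [symmetric] by auto
      then show "cf r i l = cf [:[:c0:], [:c1:]:] i l"
        by (auto simp: c0_def c1_def coeff_pCons le_Suc_eq split: nat.splits)
    qed
    then have "r = cob \<Delta> D 0 + smult [:1:] [:[:c0:], [:c1:]:]" "(c0, c1) \<noteq> (0, 0) \<Longrightarrow> [:[:c0:], [:c1:]:] \<in> vir_list \<Delta> D"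
      using True by (auto simp: cob_def vir_list_def)
    moreover have "r = cob \<Delta> D 0 + smult [:0:] 0" if "(c0, c1) = (0, 0)"
      using that \<open>r = [:[:c0:], [:c1:]:]\<close> by (simp add: cob_def)
    ultimately show ?thesis by blast
  next
    case ne: False
    show ?thesis
    proof (cases "r = 0")
      case True
      then have "r = cob \<Delta> D 0 + smult [:0:] 0" by (simp add: cob_def)
      then show ?thesis by blast
    next
      case False
      then obtain i0 l0 where "cf r i0 l0 \<noteq> 0"
        by (metis coeff_0 poly_eqI)
      then have l0: "l0 \<ge> 1" "of_nat (i0 + l0 - 1) = \<Delta> - D"
        using q ne unfolding r_def by blast+
      define N where "N = i0 + l0"
      have \<Delta>: "\<Delta> = D + of_nat N - 1"
        using l0 by (simp add: N_def of_nat_diff) algebra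
      have "N \<noteq> 1" using \<Delta> ne by auto
      then have N: "N \<ge> 2" using l0 by (simp add: N_def)
      have supp: "i + l = N \<and> 1 \<le> l" if "cf r i l \<noteq> 0" for i l
      proof -
        have *: "l \<ge> 1" "of_nat (i + l - 1) = \<Delta> - D"
          using q that ne unfolding r_def by blast+
        then have "i + l - 1 = i0 + l0 - 1"
          using l0(2) by (metis of_nat_eq_iff)
        then show ?thesis using * l0 by (simp add: N_def)
      qed
      \<comment> \<open>In the coefficient of \<open>z^N w\<close> all other terms cancel because
        \<Delta> = D + N - 1.\<close>
      have "cf r (N - 1) 1 * D = 0"
      proof -
        have "bw D (N - 1) N = D" "bw D 0 1 = D"
          using N by (simp_all add: bw_def binomial_eq_0)
        then have "cf r (N - 1) 1 * D + \<Delta> * cf r 0 N - cf r 0 N * D = cf r 0 N * (of_nat N - 1)"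
          using L_cocycle_coeff [OF r, of 1 N 0] N by simp
        then show ?thesis using \<Delta> by algebra
      qed
      then have "cf r (N - 1) 1 = 0" using D0 by simp
      have "homog N r"
        unfolding homog_def
      proof (intro allI impI)
        fix i l
        assume *: "cf r i l \<noteq> 0"
        then have "i + l = N" "1 \<le> l" using supp by auto
        moreover have "l \<noteq> 1"
          using * \<open>cf r (N - 1) 1 = 0\<close> \<open>i + l = N\<close> by auto
        ultimately show "i + l = N \<and> 2 \<le> l" by simp
      qed
      then show ?thesis
        using homog_classification r D0 N \<Delta> by blast
    qed
  qed
  then obtain q' c e where "r = cob \<Delta> D q' + smult [:c:] e" "c = 0 \<or> e \<in> vir_list \<Delta> D"
    by blast
  then have "f = cob \<Delta> D (q + q') + smult [:c:] e"
    unfolding r_def cob_add [symmetric] by (simp add: algebra_simps)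
  with \<open>c = 0 \<or> e \<in> vir_list \<Delta> D\<close> show ?thesis by blast
qed

section \<open>Comparison with the list\<close>

text \<open>The solutions \<open>h\<close> for \<alpha> = 0. Equivalences do not change
  \<open>h\<close>, so the scalar \<open>a\<close> is kept.\<close>

definition sch_list :: "complex \<Rightarrow> complex \<Rightarrow> bipoly set" where
  "sch_list \<Delta> D = {h. \<exists>a. a \<noteq> 0 \<and>
     ((\<Delta> - D = -1/2 \<and> h = homp [a])
    \<or> (\<Delta> - D = 1/2 \<and> h = homp [a, a * (2 * D)])
    \<or> (\<Delta> = 1 \<and> D = -1/2 \<and> h = homp [a, 0, -a]))}"

lemma sch_list_cocycle:
  assumes "h \<in> sch_list \<Delta> D"
  shows "Y_cocycle 0 0 \<Delta> D h" "h \<noteq> 0"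
proof -
  note bevs = bev_homp lessThan_Suc algebra_simps power2_eq_square
  obtain a where a: "a \<noteq> 0" and "\<Delta> - D = -1/2 \<and> h = homp [a] \<or> \<Delta> - D = 1/2 \<and> h = homp [a, a * (2 * D)]
      \<or> \<Delta> = 1 \<and> D = -1/2 \<and> h = homp [a, 0, -a]"
    using assms unfolding sch_list_def by blast
  then have "Y_cocycle 0 0 \<Delta> D h \<and> h \<noteq> 0"
  proof (elim disjE conjE, goal_cases)
    case 1
    have \<Delta>: "\<Delta> = D - 1/2" using 1(2) by (simp add: field_simps)
    have "cf h 0 0 \<noteq> 0" unfolding 1(3) by (simp add: cf_homp a)
    then show ?case unfolding \<Delta> 1(3) by (auto simp: Y_cocycle_def bevs)
  next
    case 2
    have \<Delta>: "\<Delta> = D + 1/2" using 2(2) by (simp add: field_simps)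
    have "cf h 1 0 \<noteq> 0" unfolding 2(3) by (simp add: cf_homp a)
    then show ?case unfolding \<Delta> 2(3) by (auto simp: Y_cocycle_def bevs)
  next
    case 3
    have "cf h 2 0 \<noteq> 0" unfolding 3(4) by (simp add: cf_homp a)
    then show ?case unfolding 3(2-4) by (auto simp: Y_cocycle_def bevs)
  qed
  then show "Y_cocycle 0 0 \<Delta> D h" "h \<noteq> 0" by blast+
qed

section \<open>Translation by \<alpha> and comparison of the lists\<close>

lemma L_cocycle_translate:
  assumes f: "\<And>x z. bev f x z = bev e (x + \<alpha>) z"
  shows "L_cocycle \<alpha> \<alpha> \<Delta> D f \<longleftrightarrow> L_cocycle 0 0 \<Delta> D e"
proof
  assume L: "L_cocycle \<alpha> \<alpha> \<Delta> D f"
  show "L_cocycle 0 0 \<Delta> D e"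
    unfolding L_cocycle_def
  proof (intro allI, goal_cases)
    case (1 x z w)
    have "x - \<alpha> + z + \<alpha> = x + z" "x - \<alpha> + w + \<alpha> = x + w" by simp_all
    then show ?case
      using L [unfolded L_cocycle_def, rule_format, of "x - \<alpha>" z w] unfolding f
      by (simp add: algebra_simps)
  qed
next
  assume L: "L_cocycle 0 0 \<Delta> D e"
  show "L_cocycle \<alpha> \<alpha> \<Delta> D f"
    unfolding L_cocycle_def
  proof (intro allI, goal_cases)
    case (1 x z w)
    show ?case
      using L [unfolded L_cocycle_def, rule_format, of "x + \<alpha>" z w] unfolding f
      by (simp add: algebra_simps)
  qed
qed

lemma Y_cocycle_translate:
  assumes f: "\<And>x z. bev f x z = bev e (x + \<alpha>) z"
  shows "Y_cocycle \<alpha> \<alpha> \<Delta> D f \<longleftrightarrow> Y_cocycle 0 0 \<Delta> D e"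
proof
  assume L: "Y_cocycle \<alpha> \<alpha> \<Delta> D f"
  show "Y_cocycle 0 0 \<Delta> D e"
    unfolding Y_cocycle_def
  proof (intro allI, goal_cases)
    case (1 x z w)
    have "x - \<alpha> + z + \<alpha> = x + z" by simp
    then show ?case
      using L [unfolded Y_cocycle_def, rule_format, of "x - \<alpha>" z w] unfolding f
      by (simp add: algebra_simps)
  qed
next
  assume L: "Y_cocycle 0 0 \<Delta> D e"
  show "Y_cocycle \<alpha> \<alpha> \<Delta> D f"
    unfolding Y_cocycle_def
  proof (intro allI, goal_cases)
    case (1 x z w)
    show ?case
      using L [unfolded Y_cocycle_def, rule_format, of "x + \<alpha>" z w] unfolding f
      by (simp add: algebra_simps)
  qed
qed

lemma bev_generators [simp]: "bev (bconst c) x z = c" "bev blam x z = z" "bev (bdbar \<alpha>) x z = x + \<alpha>"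
  by (simp_all add: bconst_def blam_def bdbar_def)

lemma sqrt19_iff:
  fixes D :: complex
  shows "(2 * D + 5)\<^sup>2 = 19 \<longleftrightarrow> D = -5/2 + of_real (sqrt 19) / 2 \<or> D = -5/2 - of_real (sqrt 19) / 2"
proof -
  have "(19 :: complex) = (of_real (sqrt 19))\<^sup>2"
    by (simp flip: of_real_power)
  then have "(2 * D + 5)\<^sup>2 = 19 \<longleftrightarrow> 2 * D + 5 = of_real (sqrt 19) \<or> 2 * D + 5 = - of_real (sqrt 19)"
    by (metis power2_eq_iff)
  also have "\<dots> \<longleftrightarrow> D = -5/2 + of_real (sqrt 19) / 2 \<or> D = -5/2 - of_real (sqrt 19) / 2"
    by (auto simp: field_simps eq_neg_iff_add_eq_0 eq_diff_eq)
  finally show ?thesis .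
qed

lemma sqrt19_diff:
  fixes \<Delta> D :: complex
  shows "((\<Delta> = 7/2 + of_real (sqrt 19) / 2 \<and> D = -5/2 + of_real (sqrt 19) / 2) \<or>
      (\<Delta> = 7/2 - of_real (sqrt 19) / 2 \<and> D = -5/2 - of_real (sqrt 19) / 2))
     \<longleftrightarrow> \<Delta> - D = 6 \<and> (2 * D + 5)\<^sup>2 = 19"
  unfolding sqrt19_iff by (auto simp: diff_eq_eq)

lemma vir_list_in_sv_list:
  assumes "e \<in> vir_list \<Delta> D"
  shows "\<exists>f. (f, 0, 0) \<in> sv_list \<alpha> \<Delta> D \<and> (\<forall>x z. bev f x z = bev e (x + \<alpha>) z)"
  using assms unfolding vir_list_def mem_Collect_eq
proof (elim disjE conjE exE, goal_cases)
  note bevs = bev_homp lessThan_Suc power_numeral_reduce algebra_simps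
  case (1 c0 c1)
  let ?f = "bconst c0 + bconst c1 * blam"
  have "bev ?f x z = bev e (x + \<alpha>) z" for x z
    unfolding 1(3) by (simp add: bevs)
  moreover have "(?f, 0, 0) \<in> sv_list \<alpha> \<Delta> D"
    unfolding sv_list_def Let_def mem_Collect_eq
    by (rule disjI1) (use 1(1,2) in blast)
  ultimately show ?case by blast
next
  note bevs = bev_homp lessThan_Suc power_numeral_reduce algebra_simps
  case 2
  let ?f = "blam^2 * (2 * bdbar \<alpha> + blam)"
  have "bev ?f x z = bev e (x + \<alpha>) z" for x z
    unfolding 2(2) by (simp add: bevs)
  moreover have "(?f, 0, 0) \<in> sv_list \<alpha> \<Delta> D"
    using 2 unfolding sv_list_def Let_def sqrt19_diff by blast
  ultimately show ?case by blast
next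
  note bevs = bev_homp lessThan_Suc power_numeral_reduce algebra_simps
  case 3
  let ?f = "bdbar \<alpha> * blam^2 * (bdbar \<alpha> + blam)"
  have "bev ?f x z = bev e (x + \<alpha>) z" for x z
    unfolding 3(2) by (simp add: bevs)
  moreover have "(?f, 0, 0) \<in> sv_list \<alpha> \<Delta> D"
    using 3 unfolding sv_list_def Let_def sqrt19_diff by blast
  ultimately show ?case by blast
next
  note bevs = bev_homp lessThan_Suc power_numeral_reduce algebra_simps
  case 4
  let ?f = "blam^2 * (4 * bdbar \<alpha>^3 + 6 * bdbar \<alpha>^2 * blam - bdbar \<alpha> * blam^2 + bconst D * blam^3)"
  have "bev ?f x z = bev e (x + \<alpha>) z" for x z
    unfolding 4(2) by (simp add: bevs)
  moreover have "(?f, 0, 0) \<in> sv_list \<alpha> \<Delta> D"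
    using 4 unfolding sv_list_def Let_def sqrt19_diff by blast
  ultimately show ?case by blast
next
  note bevs = bev_homp lessThan_Suc power_numeral_reduce algebra_simps
  case 5
  let ?f = "bdbar \<alpha>^4 * blam^2 - 10 * bdbar \<alpha>^2 * blam^4 - 17 * bdbar \<alpha> * blam^5 - 8 * blam^6"
  have "bev ?f x z = bev e (x + \<alpha>) z" for x z
    unfolding 5(3) by (simp add: bevs)
  moreover have "(?f, 0, 0) \<in> sv_list \<alpha> \<Delta> D"
    using 5 unfolding sv_list_def Let_def sqrt19_diff by (simp add: diff_eq_eq)
  ultimately show ?case by blast
next
  note bevs = bev_homp lessThan_Suc power_numeral_reduce algebra_simps
  case 6
  let ?f = "bdbar \<alpha>^4 * blam^3 - bconst (2 * D + 3) * bdbar \<alpha>^3 * blam^4 - bconst (3 * D) * bdbar \<alpha>^2 * blam^5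
                - bconst (3 * D + 1) * bdbar \<alpha> * blam^6 - bconst (D + 9/28) * blam^7"
  have "bev ?f x z = bev e (x + \<alpha>) z" for x z
    unfolding 6(3) by (simp add: bevs)
  moreover have "(?f, 0, 0) \<in> sv_list \<alpha> \<Delta> D"
    using 6 unfolding sv_list_def Let_def sqrt19_diff by blast
  ultimately show ?case by blast
qed

lemma sv_list_cases:
  assumes "T \<in> sv_list \<alpha> \<Delta> D"
  obtains f e where "T = (f, 0, 0)" "e \<in> vir_list \<Delta> D" "\<And>x z. bev f x z = bev e (x + \<alpha>) z"
    | h u where "T = (0, 0, h)" "u \<in> sch_list \<Delta> D" "\<And>x z. bev h x z = bev u (x + \<alpha>) z"
proof -
  note bevs = bev_homp lessThan_Suc power_numeral_reduce algebra_simps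
  show thesis
    using assms unfolding sv_list_def Let_def mem_Collect_eq sqrt19_diff
  proof (elim disjE conjE exE, goal_cases)
    case (1 c0 c1)
    show ?case
      by (rule that(1) [OF 1(3), of "[:[:c0:], [:c1:]:]"]) (use 1 in \<open>simp add: vir_list_def\<close>, simp add: bevs)
  next
    case 2
    show ?case
      by (rule that(1) [OF 2(2), of "homp [0, 0, 2, 1]"]) (use 2 in \<open>simp add: vir_list_def\<close>, simp add: bevs)
  next
    case 3
    show ?case
      by (rule that(1) [OF 3(2), of "homp [0, 0, 1, 1, 0]"]) (use 3 in \<open>simp add: vir_list_def\<close>, simp add: bevs)
  next
    case 4
    show ?case
      by (rule that(1) [OF 4(2), of "homp [0, 0, 4, 6, -1, D]"]) (use 4 in \<open>simp add: vir_list_def\<close>, simp add: bevs)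
  next
    case 5
    show ?case
      by (rule that(1) [OF 5(3), of "homp [0, 0, 1, 0, -10, -17, -8]"]) (use 5 in \<open>simp add: vir_list_def\<close>, simp add: bevs)
  next
    case 6
    show ?case
      by (rule that(1) [OF 6(1), of "homp [0, 0, 0, 1, - (2 * D + 3), - (3 * D), - (3 * D + 1), - (D + 9/28)]"])
        (use 6 in \<open>simp add: vir_list_def\<close>, simp add: bevs)
  next
    case (7 a)
    have "homp [a] \<in> sch_list \<Delta> D"
      unfolding sch_list_def mem_Collect_eq by (rule exI [of _ a]) (simp add: 7)
    then show ?case
      by (rule that(2) [OF 7(3)]) (simp add: bevs)
  next
    case (8 a)
    have "homp [a, a * (2 * D)] \<in> sch_list \<Delta> D"
      unfolding sch_list_def mem_Collect_eq by (rule exI [of _ a]) (simp add: 8)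
    then show ?case
      by (rule that(2) [OF 8(3)]) (simp add: bevs)
  next
    case (9 a)
    have "homp [a, 0, - a] \<in> sch_list \<Delta> D"
      unfolding sch_list_def mem_Collect_eq by (rule exI [of _ a]) (simp add: 9)
    then show ?case
      by (rule that(2) [OF 9(4)]) (simp add: bevs)
  qed
qed

lemma sch_list_in_sv_list:
  assumes "u \<in> sch_list \<Delta> D" and h: "\<And>x z. bev h x z = bev u (x + \<alpha>) z"
  shows "(0, 0, h) \<in> sv_list \<alpha> \<Delta> D"
proof -
  note bevs = bev_homp lessThan_Suc power_numeral_reduce algebra_simps
  obtain a where "a \<noteq> 0" and "\<Delta> - D = -1/2 \<and> u = homp [a] \<or> \<Delta> - D = 1/2 \<and> u = homp [a, a * (2 * D)]
      \<or> \<Delta> = 1 \<and> D = -1/2 \<and> u = homp [a, 0, -a]"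
    using assms(1) unfolding sch_list_def by blast
  then show ?thesis
  proof (elim disjE conjE, goal_cases)
    case 1
    have "h = bconst a" by (intro bipoly_eqI) (simp add: h 1(3) bevs)
    with 1(1) have "\<exists>a0. a0 \<noteq> 0 \<and> ((0, 0, h) :: bipoly \<times> bipoly \<times> bipoly) = (0, 0, bconst a0)" by blast
    then show ?thesis unfolding sv_list_def Let_def mem_Collect_eq 1(2) by (simp only: simp_thms)
  next
    case 2
    have "h = bconst a * (bdbar \<alpha> + bconst (2 * D) * blam)" by (intro bipoly_eqI) (simp add: h 2(3) bevs)
    then have "\<exists>a0. a0 \<noteq> 0 \<and> ((0, 0, h) :: bipoly \<times> bipoly \<times> bipoly) = (0, 0, bconst a0 * (bdbar \<alpha> + bconst (2 * D) * blam))"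
      using 2(1) by blast
    with 2(2) show ?thesis unfolding sv_list_def Let_def mem_Collect_eq by (simp only: simp_thms)
  next
    case 3
    have "h = bconst a * (bdbar \<alpha>^2 - blam^2)" by (intro bipoly_eqI) (simp add: h 3(4) bevs)
    then have "\<exists>a0. a0 \<noteq> 0 \<and> ((0, 0, h) :: bipoly \<times> bipoly \<times> bipoly) = (0, 0, bconst a0 * (bdbar \<alpha>^2 - blam^2))"
      using 3(1) by blast
    with 3(2,3) show ?thesis unfolding sv_list_def Let_def mem_Collect_eq by (simp only: simp_thms)
  qed
qed

section \<open>Assembly of the classification\<close>

lemma vir_list_diff:
  assumes "e \<in> vir_list \<Delta> D"
  shows "\<Delta> - D \<in> {0, 2, 3, 4, 5, 6}"
  using assms unfolding vir_list_def by auto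

lemma L_coboundary_shift:
  "L_coboundary \<alpha> \<alpha> \<Delta> D (pcompose q [:\<alpha>, 1:]) x z = L_coboundary 0 0 \<Delta> D q (x + \<alpha>) z"
  by (simp add: L_coboundary_def poly_pcompose algebra_simps)

text \<open>With one parameter put to 0, the identities give (\<alpha>b - \<alpha>) h = 0 and
  present (\<alpha>b - \<alpha>) f as minus the coboundary of f(x, 0).\<close>

lemma different_alpha_trivial:
  assumes "is_conf_ext \<alpha> \<alpha>b \<Delta> D T" "\<alpha> \<noteq> \<alpha>b"
  shows "trivial_ext \<alpha> \<alpha>b \<Delta> D T"
proof -
  obtain f g h where T: "T = (f, g, h)" by (cases T)
  note c = is_conf_ext_D [OF assms(1) [unfolded T]]
  have "(\<alpha>b - \<alpha>) * bev h x w = 0" for x w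
    using c(3) [unfolded Y_cocycle_def, rule_format, of x 0 w] by (simp add: algebra_simps)
  then have h: "h = 0"
    using assms(2) by (intro bipoly_eqI) auto
  define p where "p = smult (1 / (\<alpha>b - \<alpha>)) (ev_lam f 0)"
  have p: "(\<alpha>b - \<alpha>) * poly p x = bev f x 0" for x
    using assms(2) by (simp add: p_def bev_def)
  have "bev 0 x z = bev f x z + L_coboundary \<alpha> \<alpha>b \<Delta> D p x z" for x z
  proof -
    have "(\<alpha>b - \<alpha>) * (bev f x z + L_coboundary \<alpha> \<alpha>b \<Delta> D p x z) = 0"
      using c(2) [unfolded L_cocycle_def, rule_format, of x z 0] p [of x] p [of "x + z"]
      unfolding L_coboundary_def by simp algebra
    then show ?thesis
      using assms(2) by auto
  qed
  then show ?thesis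
    unfolding trivial_ext_def T c(1) h by (rule ext_equiv_I)
qed

text \<open>If h = 0, the class is carried by \<open>f\<close>. If \<open>h\<close> is nonzero,
  \<Delta> - D is not an integer, so there is no Virasoro entry and \<open>f\<close> is a
  coboundary.\<close>

lemma nontrivial_ext_in_list:
  assumes D0: "D \<noteq> 0" and ext: "is_conf_ext \<alpha> \<alpha> \<Delta> D T" and nt: "\<not> trivial_ext \<alpha> \<alpha> \<Delta> D T"
  shows "\<Delta> - D \<in> {0, 2, 3, 4, 5, 6, 1/2, -1/2, 3/2} \<and>
     (\<exists>T0 \<in> sv_list \<alpha> \<Delta> D. \<exists>c. c \<noteq> 0 \<and> ext_equiv \<alpha> \<alpha> \<Delta> D T (tscale c T0))"
proof -
  obtain f g h where T: "T = (f, g, h)" by (cases T)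
  note c = is_conf_ext_D [OF ext [unfolded T]]
  have rec: "bev k x z = bev (recentre \<alpha> k) (x + \<alpha>) z" for k x z by simp
  have "L_cocycle 0 0 \<Delta> D (recentre \<alpha> f)" and Y: "Y_cocycle 0 0 \<Delta> D (recentre \<alpha> h)"
    using c L_cocycle_translate [OF rec] Y_cocycle_translate [OF rec] by blast+
  then obtain q c e where q: "recentre \<alpha> f = cob \<Delta> D q + smult [:c:] e" and e: "c = 0 \<or> e \<in> vir_list \<Delta> D"
    using L_cocycle_classification D0 by blast
  have f: "c * bev e (x + \<alpha>) z = bev f x z + L_coboundary \<alpha> \<alpha> \<Delta> D (- pcompose q [:\<alpha>, 1:]) x z" for x z
  proof -
    have "L_coboundary \<alpha> \<alpha> \<Delta> D (- pcompose q [:\<alpha>, 1:]) x z = - L_coboundary 0 0 \<Delta> D q (x + \<alpha>) z"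
      unfolding L_coboundary_shift [symmetric] by (simp add: L_coboundary_def algebra_simps)
    then show ?thesis
      unfolding rec [of f] q by simp
  qed
  show ?thesis
  proof (cases "h = 0")
    case True
    have "c \<noteq> 0"
    proof
      assume "c = 0"
      then have "ext_equiv \<alpha> \<alpha> \<Delta> D (f, 0, h) (0, 0, h)"
        using f by (intro ext_equiv_I) simp
      then show False
        using nt T \<open>g = 0\<close> True by (simp add: trivial_ext_def)
    qed
    then have e: "e \<in> vir_list \<Delta> D" using e by blast
    then obtain f0 where f0: "(f0, 0, 0) \<in> sv_list \<alpha> \<Delta> D" "\<And>x z. bev f0 x z = bev e (x + \<alpha>) z"
      using vir_list_in_sv_list by blast
    have "ext_equiv \<alpha> \<alpha> \<Delta> D T (tscale c (f0, 0, 0))"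
      unfolding T \<open>g = 0\<close> True tscale_def
      using f by (auto intro!: ext_equiv_I simp: f0(2))
    moreover have "\<Delta> - D \<in> {0, 2, 3, 4, 5, 6, 1/2, -1/2, 3/2}"
      using vir_list_diff [OF e] by blast
    ultimately show ?thesis
      using f0(1) \<open>c \<noteq> 0\<close> by blast
  next
    case False
    have "recentre \<alpha> h \<noteq> 0"
    proof
      assume "recentre \<alpha> h = 0"
      then have "h = 0" using rec [of h] by (intro bipoly_eqI) simp
      with False show False by blast
    qed
    then have u: "recentre \<alpha> h \<in> sch_list \<Delta> D"
      using Y_cocycle_classification [OF Y] D0 by (simp add: sch_list_def)
    then have diff: "\<Delta> - D = -1/2 \<or> \<Delta> - D = 1/2 \<or> \<Delta> - D = 3/2"
      unfolding sch_list_def by auto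
    have "e \<notin> vir_list \<Delta> D"
    proof
      assume "e \<in> vir_list \<Delta> D"
      \<comment> \<open>Doubling allows the comparison of even with odd integers.\<close>
      then have "2 * (\<Delta> - D) \<in> {0, 4, 6, 8, 10, 12}"
        by (drule_tac vir_list_diff) (elim insertE emptyE; simp)
      moreover have "2 * (\<Delta> - D) \<in> {-1, 1, 3}"
        using diff by (elim disjE) (erule ssubst, simp)+
      ultimately show False
        by (elim insertE emptyE) simp_all
    qed
    then have "c = 0" using e by blast
    then have "ext_equiv \<alpha> \<alpha> \<Delta> D (f, 0, h) (0, 0, h)"
      using f by (intro ext_equiv_I) simp
    moreover have "tscale 1 (0, 0, h) = (0, 0, h)"
      by (auto simp: tscale_def intro!: bipoly_eqI)
    moreover have "(0, 0, h) \<in> sv_list \<alpha> \<Delta> D"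
      using sch_list_in_sv_list [OF u rec] .
    ultimately show ?thesis
      using diff T \<open>g = 0\<close> by (metis insert_iff zero_neq_one)
  qed
qed

text \<open>For a Virasoro entry, triviality would, after translation to \<alpha> = 0, make a
  nonzero multiple of a listed cocycle a coboundary. For the other entries the nonzero
  \<open>h\<close> is invariant under equivalence.\<close>

lemma sv_list_nontrivial:
  assumes D0: "D \<noteq> 0" and T: "T \<in> sv_list \<alpha> \<Delta> D" and c: "c \<noteq> 0"
  shows "is_conf_ext \<alpha> \<alpha> \<Delta> D (tscale c T) \<and> \<not> trivial_ext \<alpha> \<alpha> \<Delta> D (tscale c T)"
  using T
proof (cases rule: sv_list_cases)
  case (1 f e)
  have T: "tscale c T = (bconst c * f, 0, 0)"
    by (simp add: 1 tscale_def)
  have f: "bev (bconst c * f) x z = bev (smult [:c:] e) (x + \<alpha>) z" for x z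
    by (simp add: 1)
  have "L_cocycle 0 0 \<Delta> D (smult [:c:] e)"
    using vir_list_nontrivial(1) [OF 1(2) D0] L_cocycle_smult by blast
  then have "is_conf_ext \<alpha> \<alpha> \<Delta> D (tscale c T)"
    unfolding T L_cocycle_translate [OF f, symmetric]
    by (rule is_conf_ext_I) (simp add: Y_cocycle_def)
  moreover have False if "trivial_ext \<alpha> \<alpha> \<Delta> D (tscale c T)"
  proof -
    have "ext_equiv \<alpha> \<alpha> \<Delta> D (bconst c * f, 0, 0) (0, 0, 0)"
      using that unfolding T trivial_ext_def .
    from ext_equiv_D(2) [OF this] obtain p
      where p: "\<And>x z. bev 0 x z = bev (bconst c * f) x z + L_coboundary \<alpha> \<alpha> \<Delta> D p x z"
      by blast
    have "smult [:c:] e = cob \<Delta> D (- pcompose p [:- \<alpha>, 1:])"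
    proof (rule bipoly_eqI)
      fix x z
      have "bev (smult [:c:] e) x z = - L_coboundary \<alpha> \<alpha> \<Delta> D p (x - \<alpha>) z"
        using p [of "x - \<alpha>" z] unfolding f by (simp add: eq_neg_iff_add_eq_0)
      also have "\<dots> = bev (cob \<Delta> D (- pcompose p [:- \<alpha>, 1:])) x z"
        by (simp add: L_coboundary_def poly_pcompose algebra_simps)
      finally show "bev (smult [:c:] e) x z = bev (cob \<Delta> D (- pcompose p [:- \<alpha>, 1:])) x z" .
    qed
    then show False
      using vir_list_nontrivial(2) [OF 1(2) D0] c by blast
  qed
  ultimately show ?thesis by blast
next
  case (2 h u)
  have T: "tscale c T = (0, 0, bconst c * h)"
    by (simp add: 2 tscale_def)
  have "Y_cocycle \<alpha> \<alpha> \<Delta> D h"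
    using sch_list_cocycle(1) [OF 2(2)] Y_cocycle_translate [OF 2(3)] by blast
  then have "Y_cocycle \<alpha> \<alpha> \<Delta> D (bconst c * h)"
    unfolding Y_cocycle_def by (simp add: mult.left_commute flip: right_diff_distrib)
  then have "is_conf_ext \<alpha> \<alpha> \<Delta> D (tscale c T)"
    unfolding T by (intro is_conf_ext_I) (simp_all add: L_cocycle_def)
  moreover have False if "trivial_ext \<alpha> \<alpha> \<Delta> D (tscale c T)"
  proof -
    have "bconst c * h = 0"
      using ext_equiv_D(1) that unfolding T trivial_ext_def by blast
    then have "h = 0"
      using c by (simp add: bconst_def)
    then have "u = 0"
      using 2(3) [of "x - \<alpha>" for x] by (intro bipoly_eqI) simp
    then show False
      using sch_list_cocycle(2) [OF 2(2)] by blast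
  qed
  ultimately show ?thesis by blast
qed

theorem theorem3p7:
  fixes \<alpha> \<alpha>b \<Delta> \<Delta>b :: complex
  assumes "\<Delta> \<noteq> 0" and "\<Delta>b \<noteq> 0"
  shows "(\<forall>T. is_conf_ext \<alpha> \<alpha>b \<Delta> \<Delta>b T \<and> \<not> trivial_ext \<alpha> \<alpha>b \<Delta> \<Delta>b T \<longrightarrow>
             \<alpha> = \<alpha>b \<and> \<Delta> - \<Delta>b \<in> {0, 2, 3, 4, 5, 6, 1/2, -1/2, 3/2} \<and>
             (\<exists>T0 \<in> sv_list \<alpha> \<Delta> \<Delta>b. \<exists>c. c \<noteq> 0 \<and> ext_equiv \<alpha> \<alpha>b \<Delta> \<Delta>b T (tscale c T0)))
       \<and> (\<alpha> = \<alpha>b \<longrightarrow> (\<forall>T0 \<in> sv_list \<alpha> \<Delta> \<Delta>b. \<forall>c. c \<noteq> 0 \<longrightarrow>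
             is_conf_ext \<alpha> \<alpha> \<Delta> \<Delta>b (tscale c T0) \<and> \<not> trivial_ext \<alpha> \<alpha> \<Delta> \<Delta>b (tscale c T0)))"
  using different_alpha_trivial nontrivial_ext_in_list [OF assms(2)] sv_list_nontrivial [OF assms(2)]
  by blast

end
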